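(* Let $\alpha$ be a non-zero algebraic number, let $h$ be the order of the torsion subgroup of the multiplicative group of the splitting field (over $\mathbb{Q}$) of the minimal polynomial of $\alpha$, and let $\zeta$ be a primitive $h$-th root of unity. Then $\mathrm{Tr}_{\mathbb{Q}(\alpha,\zeta)/\mathbb{Q}(\zeta)}(\alpha^n)=0$ for infinitely many $n\in\mathbb{N}$ if and only if $\alpha\notin\mathbb{Q}(\alpha^h,\zeta)$.
   Context: $\mathbb{N}$ denotes the non-negative integers. *)

theory Defs
  imports
    "HOL-Computational_Algebra.Computational_Algebra"
    "HOL-Algebra.Algebra"
    "HOL-Algebra.Algebraic_Closure_Type"
begin

abbreviation complex_field :: "complex ring"
  where "complex_field \<equiv> ring_of_type_algebra"

definition adjoin :: "('a, 'b) ring_scheme \<Rightarrow> 'a set \<Rightarrow> 'a set \<Rightarrow> 'a set"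
  where "adjoin R K S = generate_field R (K \<union> S)"

text \<open>
  This is a splitting field of \<open>p\<close> over \<open>K\<close> whenever \<open>p\<close> splits over \<open>R\<close>, in particular
  whenever \<open>R\<close> is algebraically closed.
\<close>
definition splitting_field :: "('a, 'b) ring_scheme \<Rightarrow> 'a set \<Rightarrow> 'a list \<Rightarrow> 'a set"
  where "splitting_field R K p = adjoin R K {x. ring.is_root R p x}"

definition torsion :: "('a, 'b) monoid_scheme \<Rightarrow> 'a set"
  where "torsion G = {x \<in> carrier G. \<exists>n::nat. 0 < n \<and> x [^]\<^bsub>G\<^esub> n = \<one>\<^bsub>G\<^esub>}"

text \<open>The positivity of \<open>n\<close> is needed because \<open>group.ord\<close> is 0 on elements of infinite order.\<close>
definition primitive_root_of_unity :: "('a, 'b) ring_scheme \<Rightarrow> nat \<Rightarrow> 'a \<Rightarrow> bool"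
  where "primitive_root_of_unity R n z \<longleftrightarrow>
    0 < n \<and> z \<in> carrier (Multiplicative_Group.mult_of R) \<and>
    group.ord (Multiplicative_Group.mult_of R) z = n"

context ring
begin

definition is_basis :: "'a set \<Rightarrow> 'a set \<Rightarrow> 'a list \<Rightarrow> bool"
  where "is_basis K L Bs \<longleftrightarrow> independent K Bs \<and> Span K Bs = L"

text \<open>
  \<open>M\<close> is the matrix, with entries in \<open>K\<close>, of multiplication by \<open>a\<close> with respect to \<open>Bs\<close>; its
  \<open>j\<close>-th column holds the coordinates of \<open>a \<otimes> Bs ! j\<close>.
\<close>
definition mult_matrix :: "'a set \<Rightarrow> 'a list \<Rightarrow> 'a \<Rightarrow> (nat \<Rightarrow> nat \<Rightarrow> 'a) \<Rightarrow> bool"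
  where "mult_matrix K Bs a M \<longleftrightarrow>
    (\<forall>i < length Bs. \<forall>j < length Bs. M i j \<in> K) \<and>
    (\<forall>j < length Bs. a \<otimes> Bs ! j = combine (map (\<lambda>i. M i j) [0..<length Bs]) Bs)"

text \<open>
  The trace of the \<open>K\<close>-linear map \<open>x \<mapsto> a \<otimes> x\<close> on \<open>L\<close>. It is meaningful when \<open>L\<close> is a finite
  extension of \<open>K\<close> and \<open>a \<in> L\<close>; for subfields of the complex numbers see the lemma
  \<open>field_trace_eq\<close> below.
\<close>
definition field_trace :: "'a set \<Rightarrow> 'a set \<Rightarrow> 'a \<Rightarrow> 'a"
  where "field_trace K L a = (THE t. \<exists>Bs M. is_basis K L Bs \<and> mult_matrix K Bs a M \<and>
    t = (\<Oplus>i \<in> {..<length Bs}. M i i))"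

end

lemma complex_field_sel [simp]:
  "carrier complex_field = UNIV" "x \<otimes>\<^bsub>complex_field\<^esub> y = x * y" "\<one>\<^bsub>complex_field\<^esub> = 1"
  "x \<oplus>\<^bsub>complex_field\<^esub> y = x + y" "\<zero>\<^bsub>complex_field\<^esub> = 0"
  by (simp_all add: ring_of_type_algebra_def)

interpretation CF: cring complex_field
  by (rule cring_from_type_algebra)

lemma subfield_adjoin: "subfield (adjoin complex_field K S) complex_field"
  unfolding adjoin_def by (rule field.generate_field_is_subfield[OF field_from_type_algebra]) simp

lemma finsum_complex_field:
  "finite A \<Longrightarrow> finsum complex_field f A = sum f A"
  by (induction A rule: finite_induct) (simp_all add: CF.finsum_insert)

lemma combine_complex_field:
  "length Ks = length Us \<Longrightarrow> CF.combine Ks Us = (\<Sum>i<length Us. Ks ! i * Us ! i)"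
proof (induction Ks Us rule: list_induct2)
  case (Cons k Ks u Us)
  show ?case
    using Cons.IH by (simp add: sum.lessThan_Suc_shift del: sum.lessThan_Suc)
qed simp

lemma independent_coords_eq:
  assumes K: "subfield K complex_field" and ind: "CF.independent K Us"
    and f: "\<And>i. i < length Us \<Longrightarrow> f i \<in> K" and g: "\<And>i. i < length Us \<Longrightarrow> g i \<in> K"
    and eq: "(\<Sum>i<length Us. f i * Us ! i) = (\<Sum>i<length Us. g i * Us ! i)"
    and i: "i < length Us"
  shows "f i = g i"
proof -
  define Ks where "Ks = map (\<lambda>i. f i - g i) [0..<length Us]"
  have neg: "- x \<in> K" if "x \<in> K" for x
  proof -
    have "\<ominus>\<^bsub>complex_field\<^esub> x \<in> K"
      using K that by (meson subfieldE(1) subringE(5))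
    moreover have "\<ominus>\<^bsub>complex_field\<^esub> x = - x"
      using CF.l_neg[of x] by (simp add: eq_neg_iff_add_eq_0)
    ultimately show ?thesis by simp
  qed
  have diff: "x - y \<in> K" if "x \<in> K" "y \<in> K" for x y
    using subringE(7)[OF subfieldE(1)[OF K] that(1) neg[OF that(2)]] by simp
  have sub: "set Ks \<subseteq> K"
    using f g diff by (auto simp: Ks_def)
  have "CF.combine Ks Us = (\<Sum>i<length Us. Ks ! i * Us ! i)"
    by (rule combine_complex_field) (simp add: Ks_def)
  also have "\<dots> = 0"
    using eq by (simp add: Ks_def algebra_simps sum_subtractf)
  finally have "set (take (length Us) Ks) \<subseteq> {0}"
    using CF.independent_imp_trivial_combine[OF K ind sub] by simp
  hence "set Ks \<subseteq> {0}" by (simp add: Ks_def)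
  moreover have "Ks ! i \<in> set Ks" using i by (simp add: Ks_def)
  ultimately have "Ks ! i = 0" by blast
  thus ?thesis using i by (simp add: Ks_def)
qed

lemma Span_coords:
  assumes K: "subfield K complex_field" and x: "x \<in> CF.Span K Us"
  shows "\<exists>c. (\<forall>i<length Us. c i \<in> K) \<and> x = (\<Sum>i<length Us. c i * Us ! i)"
proof -
  obtain Ks where "length Ks = length Us" "set Ks \<subseteq> K" "x = CF.combine Ks Us"
    using x CF.Span_eq_combine_set_length_version[OF K, of Us] by auto
  thus ?thesis
    by (intro exI[of _ "\<lambda>i. Ks ! i"]) (auto simp: combine_complex_field)
qed

lemma ex_coord_matrix:
  assumes K: "subfield K complex_field" and w: "\<And>j. j < n \<Longrightarrow> w j \<in> CF.Span K Us"
  shows "\<exists>P. \<forall>j<n. (\<forall>i<length Us. P i j \<in> K) \<and> w j = (\<Sum>i<length Us. P i j * Us ! i)"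
proof -
  have "\<forall>j\<in>{..<n}. \<exists>c. (\<forall>i<length Us. c i \<in> K) \<and> w j = (\<Sum>i<length Us. c i * Us ! i)"
    using Span_coords[OF K w] by simp
  from bchoice[OF this] obtain c
    where "\<forall>j\<in>{..<n}. (\<forall>i<length Us. c j i \<in> K) \<and> w j = (\<Sum>i<length Us. c j i * Us ! i)"
    by (rule exE)
  thus ?thesis by (intro exI[of _ "\<lambda>i j. c j i"]) simp
qed

lemma sum_mult_swap:
  fixes p :: "'i \<Rightarrow> 'k \<Rightarrow> 'c::comm_semiring_0"
  shows "(\<Sum>k\<in>A. q k * (\<Sum>i\<in>B. p i k * u i)) = (\<Sum>i\<in>B. (\<Sum>k\<in>A. p i k * q k) * u i)"
proof -
  have "(\<Sum>k\<in>A. q k * (\<Sum>i\<in>B. p i k * u i)) = (\<Sum>k\<in>A. \<Sum>i\<in>B. p i k * q k * u i)"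
    by (simp add: sum_distrib_left mult_ac)
  also have "\<dots> = (\<Sum>i\<in>B. \<Sum>k\<in>A. p i k * q k * u i)"
    by (rule sum.swap)
  finally show ?thesis by (simp add: sum_distrib_right)
qed

lemma mult_matrix_trace_unique:
  assumes K: "subfield K complex_field"
    and U: "CF.is_basis K L Us" "CF.mult_matrix K Us a A"
    and V: "CF.is_basis K L Vs" "CF.mult_matrix K Vs a B"
  shows "(\<Sum>i<length Us. A i i) = (\<Sum>i<length Vs. B i i)"
proof -
  define m where "m = length Us"
  define n where "n = length Vs"
  have ind: "CF.independent K Us" "CF.independent K Vs"
    and span: "CF.Span K Us = L" "CF.Span K Vs = L"
    using U V by (auto simp: CF.is_basis_def)
  have add: "x + y \<in> K" and mul: "x * y \<in> K" if "x \<in> K" "y \<in> K" for x y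
    using subringE(6,7)[OF subfieldE(1)[OF K] that] by auto
  have zero: "0 \<in> K" using subringE(2)[OF subfieldE(1)[OF K]] by simp
  have one: "1 \<in> K" using subringE(3)[OF subfieldE(1)[OF K]] by simp
  have sumK: "sum f S \<in> K" if "\<And>i. i \<in> S \<Longrightarrow> f i \<in> K" for f and S :: "nat set"
    using that by (induction S rule: infinite_finite_induct) (auto intro: add zero)
  have AK: "A i j \<in> K" and Aeq: "a * Us ! j = (\<Sum>i<m. A i j * Us ! i)"
    if "i < m" "j < m" for i j
    using U(2) that by (auto simp: CF.mult_matrix_def m_def combine_complex_field)
  have BK: "B i j \<in> K" and Beq: "a * Vs ! j = (\<Sum>i<n. B i j * Vs ! i)"
    if "i < n" "j < n" for i j
    using V(2) that by (auto simp: CF.mult_matrix_def n_def combine_complex_field)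
  have subU: "set Us \<subseteq> L" and subV: "set Vs \<subseteq> L"
    using CF.Span_base_incl[OF K, of Us] CF.Span_base_incl[OF K, of Vs] span by auto
  have "\<exists>P. \<forall>j<n. (\<forall>i<m. P i j \<in> K) \<and> Vs ! j = (\<Sum>i<m. P i j * Us ! i)"
    unfolding m_def by (rule ex_coord_matrix[OF K]) (use span subV n_def in \<open>auto intro: nth_mem\<close>)
  then obtain P
    where P0: "\<forall>j<n. (\<forall>i<m. P i j \<in> K) \<and> Vs ! j = (\<Sum>i<m. P i j * Us ! i)" by (rule exE)
  have PK: "\<And>i j. i < m \<Longrightarrow> j < n \<Longrightarrow> P i j \<in> K"
    and P: "\<And>j. j < n \<Longrightarrow> Vs ! j = (\<Sum>i<m. P i j * Us ! i)" using P0 by blast+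
  have "\<exists>Q. \<forall>j<m. (\<forall>i<n. Q i j \<in> K) \<and> Us ! j = (\<Sum>i<n. Q i j * Vs ! i)"
    unfolding n_def by (rule ex_coord_matrix[OF K]) (use span subU m_def in \<open>auto intro: nth_mem\<close>)
  then obtain Q
    where Q0: "\<forall>j<m. (\<forall>i<n. Q i j \<in> K) \<and> Us ! j = (\<Sum>i<n. Q i j * Vs ! i)" by (rule exE)
  have QK: "\<And>i j. i < n \<Longrightarrow> j < m \<Longrightarrow> Q i j \<in> K"
    and Q: "\<And>j. j < m \<Longrightarrow> Us ! j = (\<Sum>i<n. Q i j * Vs ! i)" using Q0 by blast+
  have PQ: "(\<Sum>k<n. P i k * Q k j) = (if i = j then 1 else 0)" if ij: "i < m" "j < m" for i j
  proof (rule independent_coords_eq[where i = i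
        and f = "\<lambda>i. \<Sum>k<n. P i k * Q k j"
        and g = "\<lambda>i. if i = j then 1 else 0",
        OF K ind(1)])
    have "Us ! j = (\<Sum>k<n. Q k j * (\<Sum>i<m. P i k * Us ! i))"
      using Q[OF ij(2)] P by simp
    also have "\<dots> = (\<Sum>i<m. (\<Sum>k<n. P i k * Q k j) * Us ! i)"
      by (rule sum_mult_swap)
    finally show "(\<Sum>i<length Us. (\<Sum>k<n. P i k * Q k j) * Us ! i) =
        (\<Sum>i<length Us. (if i = j then 1 else 0) * Us ! i)"
      using ij by (simp add: m_def if_distrib[of "\<lambda>x. x * _"] sum.delta cong: if_cong)
  qed (use ij PK QK one zero in \<open>auto simp: m_def intro!: sumK mul\<close>)
  have QP: "(\<Sum>k<m. Q i k * P k j) = (if i = j then 1 else 0)" if ij: "i < n" "j < n" for i j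
  proof (rule independent_coords_eq[where i = i
        and f = "\<lambda>i. \<Sum>k<m. Q i k * P k j"
        and g = "\<lambda>i. if i = j then 1 else 0",
        OF K ind(2)])
    have "Vs ! j = (\<Sum>k<m. P k j * (\<Sum>i<n. Q i k * Vs ! i))"
      using P[OF ij(2)] Q by simp
    also have "\<dots> = (\<Sum>i<n. (\<Sum>k<m. Q i k * P k j) * Vs ! i)"
      by (rule sum_mult_swap)
    finally show "(\<Sum>i<length Vs. (\<Sum>k<m. Q i k * P k j) * Vs ! i) =
        (\<Sum>i<length Vs. (if i = j then 1 else 0) * Vs ! i)"
      using ij by (simp add: n_def if_distrib[of "\<lambda>x. x * _"] sum.delta cong: if_cong)
  qed (use ij PK QK one zero in \<open>auto simp: n_def intro!: sumK mul\<close>)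
  have AP: "(\<Sum>k<m. A i k * P k j) = (\<Sum>k<n. P i k * B k j)" if ij: "i < m" "j < n" for i j
  proof (rule independent_coords_eq[where i = i
        and f = "\<lambda>i. \<Sum>k<m. A i k * P k j"
        and g = "\<lambda>i. \<Sum>k<n. P i k * B k j",
        OF K ind(1)])
    have "(\<Sum>i<m. (\<Sum>k<m. A i k * P k j) * Us ! i) = (\<Sum>k<m. P k j * (\<Sum>i<m. A i k * Us ! i))"
      by (rule sum_mult_swap [symmetric])
    also have "\<dots> = (\<Sum>k<m. P k j * (a * Us ! k))"
      using Aeq by (intro sum.cong) auto
    also have "\<dots> = a * Vs ! j"
      using P[OF ij(2)] by (simp add: sum_distrib_left mult_ac)
    also have "\<dots> = (\<Sum>k<n. B k j * (\<Sum>i<m. P i k * Us ! i))"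
      using Beq[OF ij(2) ij(2)] P by simp
    also have "\<dots> = (\<Sum>i<m. (\<Sum>k<n. P i k * B k j) * Us ! i)"
      by (rule sum_mult_swap)
    finally show "(\<Sum>i<length Us. (\<Sum>k<m. A i k * P k j) * Us ! i) =
        (\<Sum>i<length Us. (\<Sum>k<n. P i k * B k j) * Us ! i)" by (simp add: m_def)
  qed (use ij PK AK BK in \<open>auto simp: m_def intro!: sumK mul\<close>)
  have "(\<Sum>i<m. A i i) = (\<Sum>i<m. \<Sum>k<m. A i k * (if k = i then 1 else 0))"
    by (simp add: if_distrib[of "\<lambda>x. _ * x"] sum.delta cong: if_cong)
  also have "\<dots> = (\<Sum>i<m. \<Sum>k<m. A i k * (\<Sum>l<n. P k l * Q l i))"
    by (intro sum.cong refl, subst PQ) auto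
  also have "\<dots> = (\<Sum>i<m. \<Sum>l<n. (\<Sum>k<m. A i k * P k l) * Q l i)"
    using sum_mult_swap[of "\<lambda>k. A i k" "\<lambda>l k. P k l" "\<lambda>l. Q l i" "{..<n}" "{..<m}" for i]
    by (simp add: mult.commute)
  also have "\<dots> = (\<Sum>i<m. \<Sum>l<n. (\<Sum>k<n. P i k * B k l) * Q l i)"
    by (intro sum.cong refl, subst AP) auto
  also have "\<dots> = (\<Sum>l<n. \<Sum>i<m. \<Sum>k<n. P i k * B k l * Q l i)"
    by (subst sum.swap) (simp add: sum_distrib_right)
  also have "\<dots> = (\<Sum>l<n. \<Sum>k<n. B k l * (\<Sum>i<m. Q l i * P i k))"
  proof (rule sum.cong[OF refl])
    fix l
    have "(\<Sum>i<m. \<Sum>k<n. P i k * B k l * Q l i) = (\<Sum>k<n. \<Sum>i<m. P i k * B k l * Q l i)"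
      by (rule sum.swap)
    thus "(\<Sum>i<m. \<Sum>k<n. P i k * B k l * Q l i) = (\<Sum>k<n. B k l * (\<Sum>i<m. Q l i * P i k))"
      by (simp add: sum_distrib_left mult_ac)
  qed
  also have "\<dots> = (\<Sum>l<n. \<Sum>k<n. B k l * (if l = k then 1 else 0))"
    by (intro sum.cong refl, subst QP) auto
  also have "\<dots> = (\<Sum>l<n. B l l)"
    by (simp add: if_distrib[of "\<lambda>x. _ * x"] sum.delta cong: if_cong)
  finally show ?thesis by (simp add: m_def n_def)
qed

lemma field_trace_eq:
  assumes "subfield K complex_field" "CF.is_basis K L Bs" "CF.mult_matrix K Bs a M"
  shows "CF.field_trace K L a = (\<Sum>i<length Bs. M i i)"
  unfolding CF.field_trace_def
proof (rule the_equality)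
  show "\<exists>Bs' M'. CF.is_basis K L Bs' \<and> CF.mult_matrix K Bs' a M' \<and>
      (\<Sum>i<length Bs. M i i) = (\<Oplus>\<^bsub>complex_field\<^esub>i \<in> {..<length Bs'}. M' i i)"
  proof (intro exI[of _ Bs] exI[of _ M] conjI)
    show "(\<Sum>i<length Bs. M i i) = (\<Oplus>\<^bsub>complex_field\<^esub>i \<in> {..<length Bs}. M i i)"
      by (simp add: finsum_complex_field)
  qed (rule assms)+
next
  fix t
  assume "\<exists>Bs' M'. CF.is_basis K L Bs' \<and> CF.mult_matrix K Bs' a M' \<and>
    t = (\<Oplus>\<^bsub>complex_field\<^esub>i \<in> {..<length Bs'}. M' i i)"
  then obtain Bs' M' where B: "CF.is_basis K L Bs'" "CF.mult_matrix K Bs' a M'"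
    and t: "t = (\<Sum>i<length Bs'. M' i i)"
    by (elim exE conjE) (simp add: finsum_complex_field)
  show "t = (\<Sum>i<length Bs. M i i)"
    unfolding t by (rule mult_matrix_trace_unique[OF assms(1) B assms(2,3)])
qed

lemma ex_mult_matrix:
  assumes K: "subfield K complex_field" and Bs: "CF.is_basis K L Bs"
    and closed: "\<And>x. x \<in> L \<Longrightarrow> a * x \<in> L"
  shows "\<exists>M. CF.mult_matrix K Bs a M"
proof -
  have sub: "set Bs \<subseteq> L"
    using CF.Span_base_incl[OF K, of Bs] Bs by (auto simp: CF.is_basis_def)
  have "a * Bs ! j \<in> CF.Span K Bs" if "j < length Bs" for j
  proof -
    have "Bs ! j \<in> L" using sub nth_mem[OF that] by (rule subsetD)
    thus ?thesis using closed Bs unfolding CF.is_basis_def by simp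
  qed
  from ex_coord_matrix[OF K this] obtain M
    where "\<forall>j<length Bs. (\<forall>i<length Bs. M i j \<in> K) \<and>
      a * Bs ! j = (\<Sum>i<length Bs. M i j * Bs ! i)"
    by (rule exE)
  thus ?thesis
    by (intro exI[of _ M]) (simp add: CF.mult_matrix_def combine_complex_field)
qed

end

theory Submission
  imports Defs
begin

text \<open>
  Let \<open>K = \<rat>(\<zeta>)\<close> and let \<open>S\<close> be the set of conjugates of \<open>\<alpha>\<close> over \<open>K\<close>, so that the trace of
  \<open>\<alpha>^n\<close> is the power sum \<open>\<Sum>x\<in>S. x^n\<close>. Let \<open>W\<close> consist of the \<open>h\<close>-th roots of unity \<open>w\<close> with
  \<open>w \<alpha> \<in> S\<close>. As \<open>w \<in> K\<close>, multiplication by \<open>w \<in> W\<close> permutes \<open>S\<close>, and \<open>\<alpha> \<in> K(\<alpha>^h)\<close> iff \<open>W\<close> is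
  trivial. If \<open>1 \<noteq> w \<in> W\<close>, then each power sum equals \<open>w^n\<close> times itself, hence vanishes for all
  \<open>n \<equiv> 1\<close> modulo \<open>h\<close>. Conversely, if the power sums vanish infinitely often, the
  Skolem-Mahler-Lech theorem yields two distinct conjugates whose ratio is a root of unity; this
  ratio lies in the splitting field, hence is an \<open>h\<close>-th root of unity, and belongs to \<open>W\<close>.

  The Skolem-Mahler-Lech theorem is proved following Hansel: after passing to a residue class of
  exponents, \<open>x^N = 1 + p\<^sup>2 g(x)\<close> for an integer polynomial \<open>g\<close>, and the binomial expansion turns
  any \<open>\<rat>\<close>-linear functional of the sum into an integer sequence
  \<open>\<Sum>j\<le>n. (n choose j) p^(2j) d j\<close>, which vanishes identically once it has infinitely many zeros.
\<close>

section \<open>Hansel's lemma\<close>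

lemma fact_eq_coprime_part_mult:
  fixes p :: nat
  assumes p: "p > 0"
  shows "fact n = (\<Prod>i | i \<in> {1..n} \<and> \<not> p dvd i. i) * p ^ (n div p) * fact (n div p)"
proof -
  have "fact n = (\<Prod>i\<in>{1..n}. i)" by (simp add: fact_prod)
  also have "{1..n} = {i \<in> {1..n}. \<not> p dvd i} \<union> {i \<in> {1..n}. p dvd i}" by blast
  also have "(\<Prod>i\<in>\<dots>. i) = (\<Prod>i | i \<in> {1..n} \<and> \<not> p dvd i. i) * (\<Prod>i | i \<in> {1..n} \<and> p dvd i. i)"
    by (rule prod.union_disjoint) auto
  also have "{i \<in> {1..n}. p dvd i} = (\<lambda>i. p * i) ` {1..n div p}"
    using p by (auto simp: dvd_def image_iff less_eq_div_iff_mult_less_eq mult.commute Suc_le_eq)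
  also have "(\<Prod>i\<in>\<dots>. i) = (\<Prod>i\<in>{1..n div p}. p * i)"
    using p by (subst prod.reindex) (auto simp: inj_on_def)
  also have "\<dots> = p ^ (n div p) * fact (n div p)"
    by (simp add: prod.distrib fact_prod)
  finally show ?thesis by (simp add: mult_ac)
qed

text \<open>This bounds the \<open>p\<close>-adic valuation of \<open>fact n\<close> by
  \<open>n\<close>: splitting off the multiples of \<open>p\<close> leaves
  \<open>fact (n div p)\<close>, to which induction applies.\<close>

lemma fact_dvd_coprime_mult_power:
  fixes p :: nat
  assumes p: "Factorial_Ring.prime p"
  shows "\<exists>c. coprime c p \<and> fact n dvd c * p ^ n"
proof (induction n rule: less_induct)
  case (less n)
  show ?case
  proof (cases "n = 0")
    case True
    thus ?thesis by (intro exI[of _ 1]) simp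
  next
    case False
    define q where "q = n div p"
    have p2: "p \<ge> 2" using p by (rule prime_ge_2_nat)
    have "q < n" using False p2 by (simp add: q_def)
    then obtain c where c: "coprime c p" "fact q dvd c * p ^ q" using less by blast
    define b where "b = (\<Prod>i | i \<in> {1..n} \<and> \<not> p dvd i. i)"
    have b: "coprime b p" unfolding b_def
      by (rule prod_coprime_left) (use p in \<open>metis (lifting) coprime_commute mem_Collect_eq prime_imp_coprime\<close>)
    \<comment> \<open>The factor \<open>p ^ q\<close> occurs twice, once from the splitting and once
      from the induction hypothesis.\<close>
    have "2 * q \<le> p * q" using p2 by simp
    also have "p * q \<le> n" by (simp add: q_def)
    finally have qn: "2 * q \<le> n" .
    have "fact n = b * p ^ q * fact q"
      using fact_eq_coprime_part_mult[of p n] p2 by (simp add: b_def q_def)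
    hence "fact n dvd b * p ^ q * (c * p ^ q)" using c(2) by simp
    also have "\<dots> = b * c * p ^ (2 * q)" by (simp add: mult_2 power_add)
    also have "\<dots> dvd b * c * p ^ n" using qn by (simp add: le_imp_power_dvd)
    finally show ?thesis using b c(1) by (intro exI[of _ "b * c"]) simp
  qed
qed

text \<open>The product of the individual cofactors works for all \<open>j \<le> M\<close> at once,
  so that one factor clears the denominators of a whole polynomial.\<close>

lemma fact_dvd_coprime_mult_power_uniform:
  fixes p :: nat
  assumes p: "Factorial_Ring.prime p"
  shows "\<exists>c. coprime c p \<and> (\<forall>j\<le>M. fact j dvd c * p ^ j)"
proof -
  obtain c where c: "\<And>j. coprime (c j) p" "\<And>j. fact j dvd c j * p ^ j"
    using fact_dvd_coprime_mult_power[OF p] by metis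
  show ?thesis
  proof (intro exI[of _ "\<Prod>j\<le>M. c j"] conjI allI impI)
    show "coprime (\<Prod>j\<le>M. c j) p" using c(1) by (intro prod_coprime_left)
    fix j assume j: "j \<le> M"
    have "c j dvd (\<Prod>j\<le>M. c j)" using j by (intro dvd_prodI) auto
    thus "fact j dvd (\<Prod>j\<le>M. c j) * p ^ j"
      using c(2)[of j] by (meson dvd_trans mult_dvd_mono dvd_refl)
  qed
qed

section \<open>Divisibility of coefficients and values by \<open>m\<close>\<close>

text \<open>For \<open>F = [:-t, 1:] * Q\<close>, the identity
  \<open>coeff Q i = coeff F (Suc i) + t * coeff Q (Suc i)\<close> carries divisibility downwards
  from above the degree, where the coefficients vanish.\<close>

lemma dvd_coeff_linear_factor:
  fixes Q :: "'a::comm_ring_1 poly"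
  assumes F: "\<And>i. i \<ge> Suc k \<Longrightarrow> m dvd coeff ([:-t, 1:] * Q) i" and i: "i \<ge> k"
  shows "m dvd coeff Q i"
  using i
proof (induction "Suc (degree Q) - i" arbitrary: i)
  case 0
  thus ?case by (simp add: coeff_eq_0)
next
  case (Suc n)
  have "m dvd coeff Q (Suc i)"
    by (cases "Suc i > degree Q") (use Suc in \<open>auto simp: coeff_eq_0 intro!: Suc.hyps(1)\<close>)
  moreover have "m dvd coeff ([:-t, 1:] * Q) (Suc i)" using Suc.prems by (intro F) simp
  moreover have "coeff ([:-t, 1:] * Q) (Suc i) = coeff Q i - t * coeff Q (Suc i)"
    by (simp add: mult_pCons_left coeff_pCons)
  ultimately show ?case
    by (metis diff_add_cancel dvd_add dvd_mult)
qed

text \<open>Hansel's key observation: a root lowers by one the index from which on the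
  coefficients are divisible by \<open>m\<close>.\<close>

lemma dvd_poly_of_roots:
  fixes F :: "'a::idom poly"
  assumes "finite T" and "\<And>i. i \<ge> card T \<Longrightarrow> m dvd coeff F i" and "\<And>t. t \<in> T \<Longrightarrow> poly F t = 0"
  shows "m dvd poly F x"
  using assms
proof (induction T arbitrary: F rule: finite_induct)
  case empty
  thus ?case by (auto simp: poly_altdef intro!: dvd_sum dvd_mult2)
next
  case (insert t T)
  have "poly F t = 0" using insert.prems by simp
  then obtain Q where Q: "F = [:-t, 1:] * Q" by (auto simp: poly_eq_0_iff_dvd)
  have "m dvd coeff Q i" if "i \<ge> card T" for i
    by (rule dvd_coeff_linear_factor[of "card T" _ t]) (use insert that Q in auto)
  moreover have "poly Q s = 0" if "s \<in> T" for s
    using insert.prems(2)[of s] insert.hyps that by (auto simp: Q)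
  ultimately have "m dvd poly Q x" by (rule insert.IH)
  thus ?case by (simp add: Q)
qed

text \<open>The falling factorial exhibits \<open>n choose j\<close> as a polynomial in
  \<open>n\<close>; for \<open>j > n\<close> both sides vanish.\<close>

lemma prod_diff_eq_fact_binomial:
  "(\<Prod>i<j. (of_nat n - of_nat i :: 'a::comm_ring_1)) = of_nat (fact j * (n choose j))"
proof (induction j)
  case (Suc j)
  show ?case
  proof (cases "j \<le> n")
    case True
    have "(n choose Suc j) * Suc j = (n choose j) * (n - j)"
      by (metis binomial_absorb_comp binomial_absorption mult.commute)
    hence *: "fact (Suc j) * (n choose Suc j) = fact j * (n choose j) * (n - j)"
      by (simp only: fact_Suc mult.assoc mult.left_commute mult.commute of_nat_id)
    show ?thesis using Suc True unfolding * by (simp add: of_nat_diff)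
  qed (use Suc in \<open>auto simp: binomial_eq_0\<close>)
qed simp

text \<open>Of the factor \<open>p^(2j)\<close>, one \<open>p^j\<close> clears the \<open>p\<close>-part of the denominator \<open>j!\<close> of the binomial
  coefficient; the other one makes the \<open>i\<close>-th coefficient of the resulting polynomial divisible
  by \<open>p^i\<close>.\<close>

theorem hansel_infinitely_many_zeros:
  fixes d :: "nat \<Rightarrow> int" and p :: nat
  assumes p: "Factorial_Ring.prime p"
    and b: "\<And>n. b n = (\<Sum>j\<le>n. of_nat (n choose j) * (int p ^ 2) ^ j * d j)"
    and inf: "infinite {n. b n = 0}"
  shows "b n = 0"
proof -
  \<comment> \<open>An integer divisible by every power of \<open>p\<close> is zero. For the
    exponent \<open>k\<close>, any \<open>k\<close> zeros of \<open>b\<close> will do.\<close>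
  have dvd: "int p ^ k dvd b n" for k
  proof -
    obtain T where T: "T \<subseteq> {n. b n = 0}" "finite T" "card T = k"
      using infinite_arbitrarily_large[OF inf] by blast
    \<comment> \<open>A common bound for \<open>n\<close> and the chosen zeros, so that one
      polynomial serves all these points.\<close>
    define M where "M = Max (insert n T)"
    have M: "n \<le> M" "\<And>t. t \<in> T \<Longrightarrow> t \<le> M" using T by (auto simp: M_def)
    obtain c where c: "coprime c p" "\<And>j. j \<le> M \<Longrightarrow> fact j dvd c * p ^ j"
      using fact_dvd_coprime_mult_power_uniform[OF p] by blast
    define e where "e j = int (c * p ^ j div fact j)" for j
    have e: "e j * fact j = int c * int p ^ j" if "j \<le> M" for j
    proof -
      have "e j * int (fact j) = int (c * p ^ j)"
        unfolding e_def of_nat_mult [symmetric] using c(2)[OF that] by simp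
      thus ?thesis by simp
    qed
    \<comment> \<open>This polynomial interpolates \<open>c * b x\<close> at all
      \<open>x \<le> M\<close>: \<open>e j\<close> absorbs the factor \<open>fact j\<close> of the
      falling factorial and uses up one of the two factors \<open>p ^ j\<close>.\<close>
    define F where "F = (\<Sum>j\<le>M. smult (int p ^ j * e j * d j) (\<Prod>i<j. [:-int i, 1:]))"
    have F: "poly F (int x) = int c * b x" if "x \<le> M" for x
    proof -
      have "poly F (int x) = (\<Sum>j\<le>M. int p ^ j * e j * d j * (fact j * int (x choose j)))"
        using prod_diff_eq_fact_binomial[of x, where 'a = int]
        by (simp add: F_def poly_sum poly_prod)
      also have "\<dots> = (\<Sum>j\<le>M. int p ^ j * (e j * fact j) * d j * int (x choose j))"
        by (simp add: mult_ac)
      also have "\<dots> = (\<Sum>j\<le>M. int c * (of_nat (x choose j) * (int p ^ 2) ^ j * d j))"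
      proof (intro sum.cong refl)
        fix j assume "j \<in> {..M}"
        hence "e j * fact j = int c * int p ^ j" by (intro e) simp
        thus "int p ^ j * (e j * fact j) * d j * int (x choose j) =
            int c * (of_nat (x choose j) * (int p ^ 2) ^ j * d j)"
          by (simp add: mult_ac power2_eq_square power_mult_distrib)
      qed
      also have "\<dots> = (\<Sum>j\<le>x. int c * (of_nat (x choose j) * (int p ^ 2) ^ j * d j))"
        using that by (intro sum.mono_neutral_right) (auto simp: binomial_eq_0)
      finally show ?thesis by (simp add: b sum_distrib_left)
    qed
    \<comment> \<open>Only summands with \<open>j \<ge> i\<close> contribute to this coefficient,
      and they carry the remaining factor \<open>p ^ j\<close>.\<close>
    have "int p ^ k dvd coeff F i" if "i \<ge> k" for i
      unfolding F_def coeff_sum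
    proof (rule dvd_sum)
      fix j assume "j \<in> {..M}"
      show "int p ^ k dvd coeff (smult (int p ^ j * e j * d j) (\<Prod>i<j. [:-int i, 1:])) i"
      proof (cases "i \<le> j")
        case True
        hence "int p ^ k dvd int p ^ j" using that by (intro le_imp_power_dvd) simp
        thus ?thesis by simp
      next
        case False
        have "degree (\<Prod>i<j. [:-int i, 1:]) = j" by (subst degree_prod_eq_sum_degree) auto
        thus ?thesis using False by (simp add: coeff_eq_0)
      qed
    qed
    moreover have "card (int ` T) = k" using T by (simp add: card_image)
    ultimately have "int p ^ k dvd poly F (int n)"
      using T M F by (intro dvd_poly_of_roots[of "int ` T"]) auto
    hence "int p ^ k dvd int c * b n" using F M by simp
    moreover have "coprime (int p ^ k) (int c)"
      using c(1) by (simp add: coprime_commute)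
    ultimately show ?thesis by (simp add: coprime_dvd_mult_right_iff)
  qed
  show ?thesis
  proof (rule ccontr)
    assume nz: "b n \<noteq> 0"
    \<comment> \<open>For this exponent, \<open>p ^ k\<close> exceeds the absolute value of
      \<open>b n\<close>.\<close>
    define k where "k = nat \<bar>b n\<bar>"
    have "k < p ^ k"
      by (rule less_le_trans[OF less_exp power_mono[OF prime_ge_2_nat[OF p]]]) simp
    hence "int k < int p ^ k" by (simp flip: of_nat_power)
    moreover have "\<bar>int p ^ k\<bar> \<le> \<bar>b n\<bar>"
      by (rule dvd_imp_le_int[OF nz dvd])
    ultimately show False by (simp add: k_def)
  qed
qed

section \<open>The Skolem-Mahler-Lech theorem\<close>

lemma poly_int_add: "poly (map_poly of_int (f + g)) x = poly (map_poly of_int f) x + poly (map_poly of_int g) x"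
  for x :: "'a::comm_ring_1"
  by (subst poly_add [symmetric], rule arg_cong[of _ _ "\<lambda>p. poly p x"]) (simp add: poly_eq_iff coeff_map_poly)

lemma poly_int_smult: "poly (map_poly of_int (smult c g)) x = of_int c * poly (map_poly of_int g) x"
  for x :: "'a::comm_ring_1"
  by (subst poly_smult [symmetric], rule arg_cong[of _ _ "\<lambda>p. poly p x"]) (simp add: poly_eq_iff coeff_map_poly)

lemma poly_int_diff: "poly (map_poly of_int (f - g)) x = poly (map_poly of_int f) x - poly (map_poly of_int g) x"
  for x :: "'a::comm_ring_1"
  by (subst poly_diff [symmetric], rule arg_cong[of _ _ "\<lambda>p. poly p x"]) (simp add: poly_eq_iff coeff_map_poly)

lemma poly_int_mult: "poly (map_poly of_int (f * g)) x = poly (map_poly of_int f) x * poly (map_poly of_int g) x"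
  for x :: "'a::comm_ring_1"
  by (subst poly_mult [symmetric], rule arg_cong[of _ _ "\<lambda>p. poly p x"])
     (simp add: poly_eq_iff coeff_map_poly coeff_mult)

lemma poly_int_power: "poly (map_poly of_int (f ^ n)) x = poly (map_poly of_int f) x ^ n"
  for x :: "'a::comm_ring_1"
  by (induction n) (simp_all add: poly_int_mult)

lemma poly_int_prod: "poly (map_poly of_int (prod f A)) x = (\<Prod>a\<in>A. poly (map_poly of_int (f a)) x)"
  for x :: "'a::comm_ring_1"
  by (induction A rule: infinite_finite_induct) (simp_all add: poly_int_mult)

lemma poly_int_sum: "poly (map_poly of_int (sum f A)) x = (\<Sum>a\<in>A. poly (map_poly of_int (f a)) x)"
  for x :: "'a::comm_ring_1"
  by (induction A rule: infinite_finite_induct) (simp_all add: poly_int_add)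

section \<open>Monic division and powers modulo \<open>f\<close> and \<open>m\<close>\<close>

text \<open>Long division by a monic polynomial inverts no coefficient and so stays inside any set
  \<open>R\<close> closed under the ring operations. This serves both integer polynomials and
  polynomials over a subfield.\<close>

lemma monic_division:
  fixes f g :: "'a::comm_ring_1 poly"
  assumes R: "0 \<in> R" "\<And>x y. x \<in> R \<Longrightarrow> y \<in> R \<Longrightarrow> x + y \<in> R" "\<And>x y. x \<in> R \<Longrightarrow> y \<in> R \<Longrightarrow> x * y \<in> R"
      "\<And>x. x \<in> R \<Longrightarrow> - x \<in> R"
    and f: "lead_coeff f = 1" "\<And>i. coeff f i \<in> R" and g: "\<And>i. coeff g i \<in> R"
  shows "\<exists>q r. g = f * q + r \<and> (r = 0 \<or> degree r < degree f) \<and> (\<forall>i. coeff q i \<in> R) \<and> (\<forall>i. coeff r i \<in> R)"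
  using g
proof (induction "degree g" arbitrary: g rule: less_induct)
  case less
  show ?case
  proof (cases "g = 0 \<or> degree g < degree f")
    case True
    thus ?thesis using less.prems R(1) by (intro exI[of _ 0] exI[of _ g]) auto
  next
    case False
    define k where "k = degree g - degree f"
    define t where "t = monom (lead_coeff g) k"
    have t: "coeff t i \<in> R" for i using R(1) less.prems by (auto simp: t_def)
    have prodR: "coeff (f * t) i \<in> R" for i
    proof -
      have "(\<Sum>j\<in>A. coeff f j * coeff t (i - j)) \<in> R" for A
        by (induction A rule: infinite_finite_induct) (use R f t in auto)
      thus ?thesis by (simp add: coeff_mult)
    qed
    define h where "h = g - f * t"
    have hR: "coeff h i \<in> R" for i
      using R(2)[OF less.prems R(4)[OF prodR]] by (simp add: h_def)
    have "f \<noteq> 0" using f by auto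
    have t0: "t \<noteq> 0" using False by (auto simp: t_def)
    have deg: "degree (f * t) \<le> degree g"
      using degree_mult_le[of f t] False by (auto simp: t_def k_def degree_monom_eq)
    have lead: "coeff (f * t) (degree g) = lead_coeff g"
      using coeff_mult_degree_sum[of f t] False f by (auto simp: t_def k_def degree_monom_eq)
    show ?thesis
    \<comment> \<open>As \<open>degree 0 = 0\<close>, the degree cannot drop strictly when
      \<open>g\<close> is constant; in that case \<open>h = 0\<close>.\<close>
    proof (cases "degree g = 0 \<or> h = 0")
      case True
      have "h = 0"
      proof (cases "degree g = 0")
        case True
        hence "degree h \<le> 0" using degree_diff_le[of g 0 "f * t"] deg by (simp add: h_def)
        moreover have "coeff h 0 = 0" using lead True by (simp add: h_def)
        ultimately show ?thesis by (metis le_zero_eq leading_coeff_0_iff)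
      qed (use True in simp)
      thus ?thesis using t R(1) by (intro exI[of _ t] exI[of _ 0]) (auto simp: h_def)
    next
      case nz: False
      have "degree h \<le> degree g" using deg by (auto simp: h_def intro!: degree_diff_le)
      moreover have "coeff h (degree g) = 0" using lead by (simp add: h_def)
      ultimately have "degree h < degree g"
        using nz by (metis le_neq_implies_less leading_coeff_0_iff)
      then obtain q r where "h = f * q + r" "r = 0 \<or> degree r < degree f"
        "\<forall>i. coeff q i \<in> R" "\<forall>i. coeff r i \<in> R" using less.hyps hR by blast
      thus ?thesis using t R(2)
        by (intro exI[of _ "q + t"] exI[of _ r]) (auto simp: h_def algebra_simps)
    qed
  qed
qed

corollary monic_division_remainder:
  fixes f g :: "'a::comm_ring_1 poly"
  assumes "lead_coeff f = 1"
  obtains q r where "g = f * q + r" "r = 0 \<or> degree r < degree f"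
  using monic_division[of UNIV f g] assms by auto

text \<open>\<open>\<int>[X]/(f, m)\<close> is a finite ring in which \<open>X\<close> is a unit, hence \<open>X\<close> has finite order.\<close>

lemma power_eq_one_mod:
  fixes f :: "int poly"
  assumes f: "lead_coeff f = 1" and m: "m > 0" "coprime (coeff f 0) m"
  obtains N g where "N > 0"
    "\<And>x::'a::comm_ring_1. poly (map_poly of_int f) x = 0 \<Longrightarrow> x ^ N = 1 + of_int m * poly (map_poly of_int g) x"
proof -
  let ?e = "\<lambda>p (x::'a). poly (map_poly of_int p) x"
  have "\<exists>r q. monom 1 n = f * q + r \<and> (r = 0 \<or> degree r < degree f)" for n
    by (rule monic_division_remainder[OF f, of "monom 1 n"]) blast
  then obtain r q where r: "\<And>n. monom 1 n = f * q n + r n" "\<And>n. r n = 0 \<or> degree (r n) < degree f"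
    by metis
  \<comment> \<open>\<open>L n\<close> encodes the class of \<open>X ^ n\<close> modulo
    \<open>f\<close> and \<open>m\<close>. Only finitely many such lists exist, so two powers
    agree.\<close>
  define L where "L n = map (\<lambda>i. coeff (r n) i mod m) [0..<degree f]" for n
  have "range L \<subseteq> {xs. set xs \<subseteq> {0..<m} \<and> length xs = degree f}"
    using m by (auto simp: L_def)
  hence "finite (range L)" by (rule finite_subset) (intro finite_lists_length_eq, simp)
  hence "\<not> inj L" using range_inj_infinite by blast
  then obtain a b where "L a = L b" "a \<noteq> b" by (auto simp: inj_def)
  then obtain a b where ab: "L a = L b" "a < b" by (metis nat_neq_iff)
  have "m dvd coeff (r b - r a) i" for i
  proof (cases "i < degree f")
    case True
    have "L b ! i = L a ! i" by (simp add: ab)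
    thus ?thesis using True by (simp add: L_def mod_eq_dvd_iff)
  next
    case False
    have "coeff (r n) i = 0" for n using r(2)[of n] False by (auto intro: coeff_eq_0)
    thus ?thesis by simp
  qed
  hence "[:m:] dvd r b - r a" by (simp add: const_poly_dvd_iff)
  then obtain g where g: "r b - r a = smult m g" by (auto elim!: dvdE)
  have 1: "x ^ b - x ^ a = of_int m * ?e g x" if "?e f x = 0" for x
  proof -
    have *: "x ^ n = ?e (r n) x" for n
    proof -
      have "x ^ n = ?e (monom 1 n) x" by (simp add: map_poly_monom poly_monom)
      also have "\<dots> = ?e (r n) x" by (subst r(1)) (simp add: poly_int_add poly_int_mult that)
      finally show ?thesis .
    qed
    have "x ^ b - x ^ a = ?e (r b - r a) x" by (simp add: * poly_int_diff)
    thus ?thesis by (simp add: g poly_int_smult)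
  qed
  \<comment> \<open>At a root \<open>x\<close> of \<open>f\<close>,
    \<open>x * poly_shift 1 f x\<close> equals minus the constant term. With the Bezout coefficient
    \<open>u\<close>, this makes \<open>f1\<close> an inverse of \<open>X\<close> modulo
    \<open>f\<close> and \<open>m\<close>.\<close>
  obtain u v where uv: "u * coeff f 0 + v * m = 1"
    using m(2) by (metis coprime_imp_gcd_eq_1 bezout_int)
  define f1 where "f1 = smult (-u) (poly_shift 1 f)"
  have 2: "x * ?e f1 x = 1 - of_int m * of_int v" if "?e f x = 0" for x
  proof -
    have "f = [:coeff f 0:] + [:0, 1:] * poly_shift 1 f"
      by (intro poly_eqI) (auto simp: coeff_pCons coeff_poly_shift split: nat.splits)
    hence "?e f x = ?e ([:coeff f 0:] + [:0, 1:] * poly_shift 1 f) x" by simp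
    hence "of_int (coeff f 0) + x * ?e (poly_shift 1 f) x = 0"
      by (simp add: poly_int_add poly_int_mult map_poly_pCons that)
    hence "x * ?e (poly_shift 1 f) x = - of_int (coeff f 0)" by (simp add: eq_neg_iff_add_eq_0 add.commute)
    moreover have "x * ?e f1 x = of_int (-u) * (x * ?e (poly_shift 1 f) x)"
      by (simp only: f1_def poly_int_smult mult.left_commute)
    ultimately have "x * ?e f1 x = of_int (u * coeff f 0)" by simp
    also have "u * coeff f 0 = 1 - m * v" using uv by (simp add: algebra_simps)
    finally show ?thesis by simp
  qed
  have "\<exists>w. \<forall>x. ?e f x = 0 \<longrightarrow> (x * ?e f1 x) ^ k = 1 + of_int m * ?e w x" for k
  proof (induction k)
    case 0
    thus ?case by (intro exI[of _ 0]) simp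
  next
    case (Suc k)
    then obtain w where w: "\<And>x. ?e f x = 0 \<Longrightarrow> (x * ?e f1 x) ^ k = 1 + of_int m * ?e w x" by blast
    have "(x * ?e f1 x) ^ Suc k = 1 + of_int m * ?e (w - [:v:] - smult (m * v) w) x"
      if "?e f x = 0" for x
    proof -
      have "(x * ?e f1 x) ^ Suc k = (1 - of_int m * of_int v) * (1 + of_int m * ?e w x)"
        by (simp only: power_Suc w[OF that]) (simp only: 2[OF that])
      also have "\<dots> = 1 + of_int m * ?e (w - [:v:] - smult (m * v) w) x"
        by (simp add: poly_int_add poly_int_diff poly_int_smult map_poly_pCons algebra_simps)
      finally show ?thesis .
    qed
    thus ?case by blast
  qed
  then obtain w where w: "\<And>x. ?e f x = 0 \<Longrightarrow> (x * ?e f1 x) ^ a = 1 + of_int m * ?e w x" by blast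
  show ?thesis
  \<comment> \<open>Multiplying \<open>x ^ b - x ^ a = m * g x\<close> by \<open>f1 x ^ a\<close>
    gives \<open>(1 + m * w x) * (x ^ (b - a) - 1) = m * g x * f1 x ^ a\<close>. Moving the
    \<open>w\<close> term to the right yields the witness.\<close>
  proof (rule that[of "b - a" "g * f1 ^ a - w * (monom 1 (b - a) - 1)"])
    show "b - a > 0" using ab by simp
    fix x :: 'a assume x: "?e f x = 0"
    have "x ^ b - x ^ a = x ^ a * (x ^ (b - a) - 1)"
      using ab by (simp add: algebra_simps flip: power_add)
    hence "(x * ?e f1 x) ^ a * (x ^ (b - a) - 1) = of_int m * ?e g x * ?e f1 x ^ a"
      using 1[OF x] by (simp add: power_mult_distrib mult_ac)
    hence "(1 + of_int m * ?e w x) * (x ^ (b - a) - 1) = of_int m * ?e g x * ?e f1 x ^ a"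
      by (simp only: w[OF x])
    hence "x ^ (b - a) - 1 = of_int m * (?e g x * ?e f1 x ^ a - ?e w x * (x ^ (b - a) - 1))"
      by (simp add: algebra_simps)
    also have "\<dots> = of_int m * ?e (g * f1 ^ a - w * (monom 1 (b - a) - 1)) x"
      by (simp add: poly_int_diff poly_int_mult poly_int_power map_poly_monom poly_monom)
    finally show "x ^ (b - a) = 1 + of_int m * ?e (g * f1 ^ a - w * (monom 1 (b - a) - 1)) x"
      by (simp add: algebra_simps)
  qed
qed

section \<open>Passage from the field to integer sequences\<close>

text \<open>A coordinate functional of a Hamel basis over \<rat>, for a coordinate in which
  \<open>z\<close> does not vanish. It lets a statement about integers detect a nonzero field
  element.\<close>

lemma exists_rat_linear_functional:
  fixes z :: "'a::field_char_0"
  assumes "z \<noteq> 0"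
  obtains \<phi> :: "'a \<Rightarrow> rat" where "\<And>x y. \<phi> (x + y) = \<phi> x + \<phi> y" "\<And>q x. \<phi> (of_rat q * x) = q * \<phi> x" "\<phi> z \<noteq> 0"
proof -
  interpret V: vector_space "\<lambda>q (x::'a). of_rat q * x"
    by unfold_locales (simp_all add: algebra_simps of_rat_add of_rat_mult)
  define B where "B = V.extend_basis {}"
  have ind: "V.independent B" and span: "V.span B = UNIV"
    using V.independent_extend_basis[OF V.independent_empty] V.span_extend_basis[OF V.independent_empty]
    by (simp_all add: B_def)
  have "\<exists>b. V.representation B z b \<noteq> 0"
  proof (rule ccontr)
    assume "\<not> ?thesis"
    hence "(\<Sum>b | V.representation B z b \<noteq> 0. of_rat (V.representation B z b) * b) = 0" by simp
    thus False using V.sum_nonzero_representation_eq[OF ind, of z] span assms by simp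
  qed
  then obtain b where "V.representation B z b \<noteq> 0" ..
  thus ?thesis
    by (intro that[of "\<lambda>x. V.representation B x b"])
       (use span in \<open>simp_all add: V.representation_add[OF ind] V.representation_scale[OF ind]\<close>)
qed

lemma rat_common_denominator:
  fixes q :: "'i \<Rightarrow> rat"
  assumes "finite A"
  obtains D :: int where "D \<noteq> 0" "\<And>i. i \<in> A \<Longrightarrow> of_int D * q i \<in> \<int>"
  using assms
proof (induction A arbitrary: thesis rule: finite_induct)
  case empty
  show ?case by (rule empty[of 1]) auto
next
  case (insert a A)
  obtain D :: int where D: "D \<noteq> 0" "\<And>i. i \<in> A \<Longrightarrow> of_int D * q i \<in> \<int>"
    using insert.IH by blast
  obtain m n where mn: "quotient_of (q a) = (m, n)" by force
  have n: "n > 0" "q a = of_int m / of_int n"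
    using quotient_of_denom_pos[OF mn] quotient_of_div[OF mn] by auto
  show ?case
  proof (rule insert.prems[of "D * n"])
    show "D * n \<noteq> 0" using D n by simp
    fix i assume "i \<in> insert a A"
    thus "of_int (D * n) * q i \<in> \<int>"
    proof
      assume "i = a"
      hence "of_int (D * n) * q i = of_int (D * m)" using n by simp
      thus ?thesis by (metis Ints_of_int)
    next
      assume "i \<in> A"
      hence "of_int n * (of_int D * q i) \<in> \<int>" by (intro Ints_mult[OF Ints_of_int D(2)])
      thus ?thesis by (simp only: of_int_mult mult_ac)
    qed
  qed
qed

text \<open>As \<open>f\<close> is monic with nonzero constant term, the elements of
  \<open>S\<close> are algebraic integers that become units modulo a large prime, as Hansel's
  argument requires.\<close>

lemma skolem_mahler_lech_monic:
  fixes c :: "'a::field_char_0 \<Rightarrow> 'a" and f :: "int poly"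
  assumes S: "finite S" and f: "lead_coeff f = 1" "coeff f 0 \<noteq> 0"
    and root: "\<And>x. x \<in> S \<Longrightarrow> poly (map_poly of_int f) x = 0"
    and inf: "infinite {n. (\<Sum>x\<in>S. c x * x ^ n) = 0}"
  shows "\<exists>N>0. \<exists>r. \<forall>n. (\<Sum>x\<in>S. c x * x ^ (r + N * n)) = 0"
proof -
  let ?e = "\<lambda>p (x::'a). poly (map_poly of_int p) x"
  \<comment> \<open>Additive in \<open>P\<close> and dependent only on \<open>P\<close> modulo
    \<open>f\<close>, hence determined by the values at \<open>monom 1 i\<close> with
    \<open>i < degree f\<close>.\<close>
  define T where "T P = (\<Sum>x\<in>S. c x * ?e P x)" for P
  obtain p :: nat where p: "Factorial_Ring.prime p" "p > nat \<bar>coeff f 0\<bar>" using bigger_prime by blast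
  have "\<not> int p dvd coeff f 0" using zdvd_imp_le[of "int p" "\<bar>coeff f 0\<bar>"] p(2) f(2) by auto
  hence "coprime (int p) (coeff f 0)" using p(1) by (intro prime_imp_coprime) simp_all
  hence "coprime (coeff f 0) (int p ^ 2)" by (simp add: coprime_commute)
  moreover have "int p ^ 2 > 0" using p(2) by simp
  ultimately obtain N g where N: "N > 0"
    and g: "\<And>x::'a. ?e f x = 0 \<Longrightarrow> x ^ N = 1 + of_int (int p ^ 2) * ?e g x"
    using power_eq_one_mod[OF f(1)] by metis
  \<comment> \<open>The zeros are sorted by their residues modulo \<open>N\<close>; one class
    contains infinitely many.\<close>
  have "{n. (\<Sum>x\<in>S. c x * x ^ n) = 0} \<subseteq>
      (\<Union>r<N. (\<lambda>n. r + N * n) ` {n. (\<Sum>x\<in>S. c x * x ^ (r + N * n)) = 0})"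
  proof
    fix n assume "n \<in> {n. (\<Sum>x\<in>S. c x * x ^ n) = 0}"
    moreover have "n = n mod N + N * (n div N)" "n mod N < N" using N by simp_all
    ultimately show "n \<in> (\<Union>r<N. (\<lambda>n. r + N * n) ` {n. (\<Sum>x\<in>S. c x * x ^ (r + N * n)) = 0})"
      by (intro UN_I[of "n mod N"] image_eqI[of _ _ "n div N"]) auto
  qed
  hence "\<exists>r. infinite {n. (\<Sum>x\<in>S. c x * x ^ (r + N * n)) = 0}"
    using inf by (metis (lifting) finite_UN_I finite_imageI finite_lessThan finite_subset)
  then obtain r where r: "infinite {n. (\<Sum>x\<in>S. c x * x ^ (r + N * n)) = 0}" ..
  have "(\<Sum>x\<in>S. c x * x ^ (r + N * n)) = 0" for n
  proof (rule ccontr)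
    assume "(\<Sum>x\<in>S. c x * x ^ (r + N * n)) \<noteq> 0"
    then obtain \<phi> :: "'a \<Rightarrow> rat" where add: "\<And>x y. \<phi> (x + y) = \<phi> x + \<phi> y"
      and scale: "\<And>q x. \<phi> (of_rat q * x) = q * \<phi> x" and nz: "\<phi> (\<Sum>x\<in>S. c x * x ^ (r + N * n)) \<noteq> 0"
      by (rule exists_rat_linear_functional) blast
    have zero: "\<phi> 0 = 0" using scale[of 0 0] by simp
    have sum: "\<phi> (sum h A) = (\<Sum>i\<in>A. \<phi> (h i))" for h and A :: "nat set"
      by (induction A rule: infinite_finite_induct) (simp_all add: add zero)
    have scale_int: "\<phi> (of_int k * x) = of_int k * \<phi> x" for k x
      using scale[of "of_int k" x] by simp
    \<comment> \<open>\<open>D\<close> clears the denominators at the powers below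
      \<open>degree f\<close>, and thus at all integer polynomials after reduction modulo
      \<open>f\<close>.\<close>
    obtain D :: int where D: "D \<noteq> 0"
      "\<And>i. i \<in> {..<degree f} \<Longrightarrow> of_int D * \<phi> (T (monom 1 i)) \<in> \<int>"
      using rat_common_denominator[of "{..<degree f}" "\<lambda>i. \<phi> (T (monom 1 i))"] by blast
    have int: "of_int D * \<phi> (T P) \<in> \<int>" for P
    proof -
      obtain q s where qs: "P = f * q + s" "s = 0 \<or> degree s < degree f"
        by (rule monic_division_remainder[OF f(1)])
      have "T P = T s" by (simp add: T_def qs(1) poly_int_add poly_int_mult root)
      also have "\<dots> = T (\<Sum>i\<le>degree s. smult (coeff s i) (monom 1 i))"
        by (subst (1) poly_as_sum_of_monoms [symmetric]) (simp add: smult_monom)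
      also have "\<dots> = (\<Sum>i\<le>degree s. of_int (coeff s i) * T (monom 1 i))"
        unfolding T_def poly_int_sum poly_int_smult sum_distrib_left
        by (subst sum.swap) (simp add: mult_ac)
      finally have "of_int D * \<phi> (T P) =
          (\<Sum>i\<le>degree s. of_int (coeff s i) * (of_int D * \<phi> (T (monom 1 i))))"
        by (simp add: sum scale_int sum_distrib_left mult_ac)
      also have "\<dots> \<in> \<int>"
      proof (intro Ints_sum)
        fix i assume "i \<in> {..degree s}"
        show "of_int (coeff s i) * (of_int D * \<phi> (T (monom 1 i))) \<in> \<int>"
        proof (cases "s = 0")
          case False
          hence "i < degree f" using qs(2) \<open>i \<in> _\<close> by auto
          thus ?thesis by (intro Ints_mult[OF Ints_of_int D(2)]) simp
        qed simp
      qed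
      finally show ?thesis .
    qed
    have "\<exists>d. of_int d = of_int D * \<phi> (T (monom 1 r * g ^ j))" for j
      using int[of "monom 1 r * g ^ j"] by (metis Ints_cases)
    then obtain d where d: "\<And>j. of_int (d j) = of_int D * \<phi> (T (monom 1 r * g ^ j))" by metis
    \<comment> \<open>The sequence for Hansel's lemma: by the binomial expansion of
      \<open>(1 + p^2 * g x) ^ n\<close> it is \<open>D\<close> times \<open>\<phi>\<close> of the
      sum at \<open>r + N * n\<close>.\<close>
    define b where "b n = (\<Sum>j\<le>n. of_nat (n choose j) * (int p ^ 2) ^ j * d j)" for n
    have b: "of_int (b n) = of_int D * \<phi> (\<Sum>x\<in>S. c x * x ^ (r + N * n))" for n
    proof -
      have "(\<Sum>x\<in>S. c x * x ^ (r + N * n)) =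
          (\<Sum>x\<in>S. \<Sum>j\<le>n. of_int (of_nat (n choose j) * (int p ^ 2) ^ j) * (c x * ?e (monom 1 r * g ^ j) x))"
      proof (intro sum.cong refl)
        fix x assume x: "x \<in> S"
        have "x ^ (N * n) = (of_int (int p ^ 2) * ?e g x + 1) ^ n"
          using g[OF root[OF x]] by (simp add: power_mult add.commute)
        also have "\<dots> = (\<Sum>j\<le>n. of_nat (n choose j) * (of_int (int p ^ 2) * ?e g x) ^ j)"
          by (subst binomial_ring) simp
        finally show "c x * x ^ (r + N * n) =
          (\<Sum>j\<le>n. of_int (of_nat (n choose j) * (int p ^ 2) ^ j) * (c x * ?e (monom 1 r * g ^ j) x))"
          by (simp add: power_add sum_distrib_left poly_int_mult poly_int_power map_poly_monom
              poly_monom power_mult_distrib mult_ac)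
      qed
      also have "\<dots> = (\<Sum>j\<le>n. of_int (of_nat (n choose j) * (int p ^ 2) ^ j) * T (monom 1 r * g ^ j))"
        unfolding T_def sum_distrib_left by (rule sum.swap)
      also have "of_int D * \<phi> \<dots> = (\<Sum>j\<le>n. of_int (of_nat (n choose j) * (int p ^ 2) ^ j) *
          (of_int D * \<phi> (T (monom 1 r * g ^ j))))"
        unfolding sum scale_int sum_distrib_left by (simp add: mult_ac)
      also have "\<dots> = of_int (b n)" by (simp add: b_def d)
      finally show ?thesis ..
    qed
    have "b n = 0" if "(\<Sum>x\<in>S. c x * x ^ (r + N * n)) = 0" for n
      using b[of n] by (simp add: that zero)
    hence "infinite {n. b n = 0}" using r by (elim infinite_super[rotated]) auto
    hence "b n = 0" by (rule hansel_infinitely_many_zeros[OF p(1) b_def])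
    thus False using b[of n] nz D(1) by simp
  qed
  thus ?thesis using N by blast
qed

section \<open>Reduction to algebraic integers\<close>

text \<open>The highest power of \<open>X\<close> can be divided out of an annihilating polynomial
  because \<open>x \<noteq> 0\<close>.\<close>

lemma algebraic_root_int_poly:
  fixes x :: "'a::field_char_0"
  assumes "algebraic x" "x \<noteq> 0"
  obtains q :: "int poly" where "coeff q 0 \<noteq> 0" "poly (map_poly of_int q) x = 0"
proof -
  obtain p' :: "'a poly" where p': "\<And>i. coeff p' i \<in> \<int>" "p' \<noteq> 0" "poly p' x = 0"
    using assms(1) by (auto elim!: algebraicE)
  have "\<exists>k. coeff p' i = of_int k" for i using p'(1) by (rule Ints_cases) blast
  then obtain k where k: "\<And>i. coeff p' i = of_int (k i)" by metis
  define p where "p = (\<Sum>i\<le>degree p'. monom (k i) i)"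
  have p_eq: "p' = map_poly of_int p"
  proof (rule poly_eqI)
    fix i
    have "k i = 0" if "i > degree p'" using k[of i] that by (simp add: coeff_eq_0)
    thus "coeff p' i = coeff (map_poly of_int p) i"
      by (auto simp: p_def coeff_map_poly coeff_sum k not_le)
  qed
  have p: "p \<noteq> 0" "poly (map_poly of_int p) x = 0" using p' by (auto simp: p_eq)
  obtain q where q: "p = [:-0, 1:] ^ order 0 p * q" "\<not> [:-0, 1:] dvd q"
    using order_decomp[OF p(1)] by blast
  have q0: "coeff q 0 \<noteq> 0" "q \<noteq> 0" using q(2) poly_eq_0_iff_dvd[of q 0] by (auto simp: poly_0_coeff_0)
  have "poly (map_poly of_int p) x = x ^ order 0 p * poly (map_poly of_int q) x"
    by (subst q(1)) (simp add: poly_int_mult poly_int_power map_poly_pCons)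
  hence qx: "poly (map_poly of_int q) x = 0" using p assms by simp
  thus ?thesis using q0 by (intro that)
qed

text \<open>With \<open>a\<close> the leading coefficient of \<open>q\<close> and
  \<open>n > 0\<close> its degree, the monic \<open>f\<close> satisfies
  \<open>f(a X) = a ^ (n - 1) * q(X)\<close>. A constant \<open>q\<close> has no root and gives
  \<open>f = 1\<close>.\<close>

lemma int_poly_scaled_monic:
  fixes q :: "int poly"
  assumes q0: "coeff q 0 \<noteq> 0"
  obtains a :: int and f where "a \<noteq> 0" "lead_coeff f = 1" "coeff f 0 \<noteq> 0"
    "\<And>x::'a::field_char_0. poly (map_poly of_int q) x = 0 \<Longrightarrow> poly (map_poly of_int f) (of_int a * x) = 0"
proof -
  define n where "n = degree q"
  define a where "a = lead_coeff q"
  define f where "f = monom 1 n + (\<Sum>i<n. monom (a ^ (n - 1 - i) * coeff q i) i)"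
  have a: "a \<noteq> 0" using q0 by (auto simp: a_def)
  have coeff: "coeff f i = (if i = n then 1 else if i < n then a ^ (n - 1 - i) * coeff q i else 0)" for i
    by (auto simp: f_def coeff_sum)
  have deg: "degree f = n"
    by (rule antisym) (auto simp: coeff intro: degree_le le_degree)
  have root: "poly (map_poly of_int f) (of_int a * x) = 0"
    if qx: "poly (map_poly of_int q) x = 0" for x :: 'a
  proof -
    have n: "n > 0"
    proof (rule ccontr)
      assume "\<not> n > 0"
      then obtain k where "q = [:k:]" unfolding n_def by (auto elim: degree_eq_zeroE)
      thus False using qx q0 by (simp add: map_poly_pCons)
    qed
    have "poly (map_poly of_int f) (of_int a * x) = (of_int a * x) ^ n +
        (\<Sum>i<n. of_int (a ^ (n - 1 - i) * coeff q i) * (of_int a * x) ^ i)"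
      by (simp add: f_def poly_int_add poly_int_sum map_poly_monom poly_monom)
    also have "(\<Sum>i<n. of_int (a ^ (n - 1 - i) * coeff q i) * (of_int a * x) ^ i) =
        of_int (a ^ (n - 1)) * (\<Sum>i<n. of_int (coeff q i) * x ^ i)"
      unfolding sum_distrib_left
    proof (intro sum.cong refl)
      fix i assume "i \<in> {..<n}"
      hence "a ^ (n - 1) = a ^ (n - 1 - i) * a ^ i" by (simp flip: power_add)
      thus "of_int (a ^ (n - 1 - i) * coeff q i) * (of_int a * x) ^ i =
          of_int (a ^ (n - 1)) * (of_int (coeff q i) * x ^ i)"
        by (simp add: power_mult_distrib)
    qed
    also have "(of_int a * x) ^ n = of_int (a ^ (n - 1)) * (of_int (coeff q n) * x ^ n)"
      using n by (cases n) (simp_all add: a_def n_def power_mult_distrib)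
    also have "\<dots> + of_int (a ^ (n - 1)) * (\<Sum>i<n. of_int (coeff q i) * x ^ i) =
        of_int (a ^ (n - 1)) * poly (map_poly of_int q) x"
    proof -
      have "degree (map_poly (of_int :: int \<Rightarrow> 'a) q) = n"
        unfolding n_def by (rule degree_map_poly) simp
      thus ?thesis
        by (simp add: poly_altdef coeff_map_poly algebra_simps flip: lessThan_Suc_atMost)
    qed
    finally show ?thesis by (simp add: qx)
  qed
  show ?thesis using a q0 root by (intro that[of a f]) (simp_all add: deg coeff)
qed

text \<open>Scaling \<open>S\<close> by a nonzero integer \<open>a\<close> multiplies the
  \<open>n\<close>-th sum by \<open>a ^ n\<close> and preserves its zeros. One \<open>a\<close>
  serves all of \<open>S\<close> because it comes from a product of annihilating
  polynomials.\<close>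

theorem skolem_mahler_lech:
  fixes c :: "'a::field_char_0 \<Rightarrow> 'a"
  assumes S: "finite S" and alg: "\<And>x. x \<in> S \<Longrightarrow> algebraic x" "0 \<notin> S"
    and inf: "infinite {n. (\<Sum>x\<in>S. c x * x ^ n) = 0}"
  shows "\<exists>N>0. \<exists>r. \<forall>n. (\<Sum>x\<in>S. c x * x ^ (r + N * n)) = 0"
proof -
  have "\<forall>x\<in>S. \<exists>q :: int poly. coeff q 0 \<noteq> 0 \<and> poly (map_poly of_int q) x = 0"
    using alg algebraic_root_int_poly by metis
  then obtain q :: "'a \<Rightarrow> int poly" where q: "\<And>x. x \<in> S \<Longrightarrow> coeff (q x) 0 \<noteq> 0"
    "\<And>x. x \<in> S \<Longrightarrow> poly (map_poly of_int (q x)) x = 0" by metis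
  have "coeff (prod q S) 0 \<noteq> 0" using S q(1) by (simp add: poly_prod flip: poly_0_coeff_0)
  then obtain a :: int and f where a: "a \<noteq> 0" and f: "lead_coeff f = 1" "coeff f 0 \<noteq> 0"
    and root: "\<And>x::'a. poly (map_poly of_int (prod q S)) x = 0 \<Longrightarrow>
      poly (map_poly of_int f) (of_int a * x) = 0"
    by (rule int_poly_scaled_monic) blast
  define S' where "S' = (\<lambda>x. of_int a * x) ` S"
  define c' where "c' y = c (y / of_int a)" for y
  have eq: "(\<Sum>y\<in>S'. c' y * y ^ n) = of_int a ^ n * (\<Sum>x\<in>S. c x * x ^ n)" for n
    unfolding S'_def using a
    by (subst sum.reindex) (auto simp: inj_on_def c'_def power_mult_distrib sum_distrib_left mult_ac)
  have "\<exists>N>0. \<exists>r. \<forall>n. (\<Sum>y\<in>S'. c' y * y ^ (r + N * n)) = 0"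
  proof (rule skolem_mahler_lech_monic[OF _ f])
    show "poly (map_poly of_int f) y = 0" if y: "y \<in> S'" for y
    proof -
      obtain x where x: "x \<in> S" "y = of_int a * x" using y by (auto simp: S'_def)
      hence "poly (map_poly of_int (prod q S)) x = 0"
        using S q(2)[of x] by (auto simp: poly_int_prod)
      thus ?thesis unfolding x(2) by (rule root)
    qed
    show "infinite {n. (\<Sum>y\<in>S'. c' y * y ^ n) = 0}" using inf a by (simp add: eq)
  qed (use S in \<open>simp add: S'_def\<close>)
  thus ?thesis using a by (simp add: eq)
qed

text \<open>Invertibility of the Vandermonde matrix: weighting the equations by the coefficients of
  a polynomial that vanishes at all nodes except \<open>y x\<close> isolates
  \<open>a x\<close>.\<close>

lemma power_sums_eq_0_imp:
  fixes y :: "'i \<Rightarrow> 'a::idom"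
  assumes S: "finite S" "inj_on y S" and zero: "\<And>n. (\<Sum>x\<in>S. a x * y x ^ n) = 0" and x: "x \<in> S"
  shows "a x = 0"
proof -
  define Q where "Q = (\<Prod>z\<in>S-{x}. [:- y z, 1:])"
  have "0 = (\<Sum>n\<le>degree Q. coeff Q n * (\<Sum>z\<in>S. a z * y z ^ n))" by (simp add: zero)
  also have "\<dots> = (\<Sum>z\<in>S. a z * poly Q (y z))"
    unfolding poly_altdef sum_distrib_left by (subst sum.swap) (simp add: mult_ac)
  also have "\<dots> = (\<Sum>z\<in>{x}. a z * poly Q (y z))"
    using S x by (intro sum.mono_neutral_right) (auto simp: Q_def poly_prod)
  finally have "a x * poly Q (y x) = 0" by simp
  moreover have "poly Q (y x) \<noteq> 0"
    using S x by (auto simp: Q_def poly_prod inj_on_def)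
  ultimately show ?thesis by simp
qed

text \<open>If the powers \<open>x ^ N\<close> were distinct, the sums along
  \<open>r + N * n\<close> would be vanishing power sums in them with the nonzero coefficients
  \<open>c x * x ^ r\<close>.\<close>

corollary skolem_mahler_lech_nondegenerate:
  fixes c :: "'a::field_char_0 \<Rightarrow> 'a"
  assumes S: "finite S" "S \<noteq> {}" and alg: "\<And>x. x \<in> S \<Longrightarrow> algebraic x" "0 \<notin> S"
    and c: "\<And>x. x \<in> S \<Longrightarrow> c x \<noteq> 0"
    and inf: "infinite {n. (\<Sum>x\<in>S. c x * x ^ n) = 0}"
  shows "\<exists>N>0. \<exists>x\<in>S. \<exists>y\<in>S. x \<noteq> y \<and> x ^ N = y ^ N"
proof -
  obtain N r where N: "N > 0" "\<And>n. (\<Sum>x\<in>S. c x * x ^ (r + N * n)) = 0"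
    using skolem_mahler_lech[OF S(1) alg inf] by blast
  have "\<not> inj_on (\<lambda>x. x ^ N) S"
  proof
    assume inj: "inj_on (\<lambda>x. x ^ N) S"
    obtain x where x: "x \<in> S" using S by blast
    have "(\<Sum>x\<in>S. c x * x ^ r * (x ^ N) ^ n) = 0" for n
      using N(2)[of n] by (simp add: power_add power_mult mult_ac)
    from power_sums_eq_0_imp[OF S(1) inj this x] show False using x c alg(2) by auto
  qed
  thus ?thesis using N(1) by (auto simp: inj_on_def)
qed

section \<open>Subfields of the complex numbers and minimal polynomials\<close>

interpretation CF: domain complex_field
  by (intro field.axioms field_from_type_algebra)

lemma a_inv_complex_field [simp]: "\<ominus>\<^bsub>complex_field\<^esub> x = - x"
  using CF.l_neg[of x] by (simp add: eq_neg_iff_add_eq_0)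

lemma m_inv_complex_field: "x \<noteq> 0 \<Longrightarrow> inv\<^bsub>complex_field\<^esub> x = inverse x"
  by (rule CF.inv_char) simp_all

lemma nat_pow_complex_field [simp]: "x [^]\<^bsub>complex_field\<^esub> (n::nat) = x ^ n"
  by (induction n) simp_all

lemma subfield_complex_fieldD:
  assumes "subfield K complex_field"
  shows "0 \<in> K" "1 \<in> K" "x \<in> K \<Longrightarrow> y \<in> K \<Longrightarrow> x + y \<in> K" "x \<in> K \<Longrightarrow> y \<in> K \<Longrightarrow> x * y \<in> K"
    "x \<in> K \<Longrightarrow> - x \<in> K" "x \<in> K \<Longrightarrow> inverse x \<in> K"
proof -
  note K = subringE[OF subfieldE(1)[OF assms]]
  show zero: "0 \<in> K" "1 \<in> K" "x \<in> K \<Longrightarrow> y \<in> K \<Longrightarrow> x + y \<in> K" "x \<in> K \<Longrightarrow> y \<in> K \<Longrightarrow> x * y \<in> K"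
    "x \<in> K \<Longrightarrow> - x \<in> K"
    using K(2,3) K(5)[of x] K(6,7)[of x y] by simp_all
  show "x \<in> K \<Longrightarrow> inverse x \<in> K"
    using CF.subfield_m_inv(1)[OF assms, of x] zero(1) by (cases "x = 0") (simp_all add: m_inv_complex_field)
qed

lemma subfield_complex_fieldI:
  assumes "1 \<in> K" "\<And>x y. x \<in> K \<Longrightarrow> y \<in> K \<Longrightarrow> x + y \<in> K" "\<And>x y. x \<in> K \<Longrightarrow> y \<in> K \<Longrightarrow> x * y \<in> K"
    "\<And>x. x \<in> K \<Longrightarrow> - x \<in> K" "\<And>x. x \<in> K \<Longrightarrow> x \<noteq> 0 \<Longrightarrow> inverse x \<in> K"
  shows "subfield K complex_field"
  by (intro field.subfieldI'[OF field_from_type_algebra] CF.subringI) (use assms in \<open>auto simp: m_inv_complex_field\<close>)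

lemma subfield_Rats: "subfield \<rat> complex_field"
  by (rule subfield_complex_fieldI) auto

lemma subfield_power_closed:
  assumes "subfield K complex_field" "x \<in> K"
  shows "x ^ n \<in> K"
  using assms by (induction n) (auto intro: subfield_complex_fieldD)

lemma subfield_of_nat_closed:
  assumes "subfield K complex_field"
  shows "of_nat n \<in> K"
  using assms by (induction n) (auto intro: subfield_complex_fieldD)

text \<open>Subfields are sets rather than types, so polynomials over \<open>K\<close> form a subset
  of those over the ambient type.\<close>

definition polys_over :: "'a::zero set \<Rightarrow> 'a poly set"
  where "polys_over K = {p. \<forall>i. coeff p i \<in> K}"

lemma polys_over_mono: "K \<subseteq> L \<Longrightarrow> polys_over K \<subseteq> polys_over L"
  by (auto simp: polys_over_def)

text \<open>The lists of \<open>CF.eval\<close> start with the leading coefficient, those of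
  \<open>Poly\<close> with the constant one.\<close>

lemma eval_complex_field: "CF.eval cs x = poly (Poly (rev cs)) x"
proof (induction cs rule: rev_induct)
  case (snoc c cs)
  thus ?case using CF.eval_append_aux[of cs c x] by simp
qed simp

lemma Poly_rev_polys_over:
  assumes "subfield K complex_field" "cs \<in> carrier (univ_poly complex_field K)"
  shows "Poly (rev cs) \<in> polys_over K"
proof -
  have "set cs \<subseteq> K" using assms(2) by (auto simp: univ_poly_def polynomial_def)
  thus ?thesis
    using subfield_complex_fieldD(1)[OF assms(1)]
    by (auto simp: polys_over_def coeff_Poly_eq nth_default_def rev_nth)
qed

lemma rev_coeffs_carrier:
  assumes "p \<in> polys_over K"
  shows "rev (coeffs p) \<in> carrier (univ_poly complex_field K)"
proof (cases "p = 0")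
  case False
  thus ?thesis using assms
    by (auto simp: polys_over_def univ_poly_def polynomial_def coeffs_def hd_rev last_coeffs_eq_coeff_degree)
qed (auto simp: univ_poly_def polynomial_def)

lemma algebraic_overI:
  assumes "p \<in> polys_over K" "p \<noteq> 0" "poly p x = 0"
  shows "(CF.algebraic over K) x"
  by (rule CF.algebraicI[OF rev_coeffs_carrier]) (use assms in \<open>auto simp: eval_complex_field\<close>)

lemma Ints_subset_subfield:
  assumes "subfield K complex_field"
  shows "\<int> \<subseteq> K"
proof
  fix x :: complex assume "x \<in> \<int>"
  then obtain k where "x = of_int k" by (rule Ints_cases)
  thus "x \<in> K"
    using subfield_of_nat_closed[OF assms] subfield_complex_fieldD(5)[OF assms]
    by (cases k rule: int_cases2) auto
qed

lemma algebraicE_over: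
  assumes "subfield K complex_field" "algebraic x"
  obtains p where "p \<in> polys_over K" "\<And>i. coeff p i \<in> \<int>" "p \<noteq> 0" "poly p x = 0"
proof -
  obtain p where p: "\<And>i. coeff p i \<in> \<int>" "p \<noteq> 0" "poly p x = 0"
    using assms(2) by (auto elim!: algebraicE)
  thus ?thesis using Ints_subset_subfield[OF assms(1)] by (intro that[of p]) (auto simp: polys_over_def)
qed

lemma algebraic_imp_algebraic_over:
  assumes "subfield K complex_field" "algebraic x"
  shows "(CF.algebraic over K) x"
  using algebraicE_over[OF assms] algebraic_overI by metis

section \<open>Minimal polynomials and conjugates\<close>

text \<open>Minimality of the degree stands in for irreducibility, so that divisibility follows from
  division with remainder.\<close>

definition min_poly_over :: "'a::idom set \<Rightarrow> 'a \<Rightarrow> 'a poly \<Rightarrow> bool"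
  where "min_poly_over K a p \<longleftrightarrow> p \<in> polys_over K \<and> lead_coeff p = 1 \<and> poly p a = 0 \<and>
    (\<forall>g\<in>polys_over K. g \<noteq> 0 \<longrightarrow> poly g a = 0 \<longrightarrow> degree p \<le> degree g)"

lemma min_poly_overD:
  assumes "min_poly_over K a p"
  shows "p \<in> polys_over K" "lead_coeff p = 1" "p \<noteq> 0" "poly p a = 0" "degree p > 0"
    "g \<in> polys_over K \<Longrightarrow> g \<noteq> 0 \<Longrightarrow> poly g a = 0 \<Longrightarrow> degree p \<le> degree g"
proof -
  show *: "p \<in> polys_over K" "lead_coeff p = 1" "p \<noteq> 0" "poly p a = 0"
    "g \<in> polys_over K \<Longrightarrow> g \<noteq> 0 \<Longrightarrow> poly g a = 0 \<Longrightarrow> degree p \<le> degree g"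
    using assms by (auto simp: min_poly_over_def)
  show "degree p > 0"
  proof (rule ccontr)
    assume "\<not> degree p > 0"
    then obtain k where "p = [:k:]" by (auto elim: degree_eq_zeroE)
    thus False using * by simp
  qed
qed

text \<open>The degree clause later matches \<open>degree p\<close> with the length of the power
  basis \<open>CF.exp_base\<close>.\<close>

lemma ex_min_poly_over:
  assumes K: "subfield K complex_field" and alg: "(CF.algebraic over K) a"
  obtains p where "min_poly_over K a p" "degree p = length (CF.Irr K a) - 1"
proof -
  note Irr = CF.IrrE[OF K _ alg, simplified]
  have ne: "CF.Irr K a \<noteq> []"
    using Irr(2) by (auto simp: ring_irreducible_def univ_poly_zero)
  define p where "p = Poly (rev (CF.Irr K a))"
  have "last (rev (CF.Irr K a)) = 1" using Irr(3) ne by (simp add: last_rev)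
  hence c: "coeffs p = rev (CF.Irr K a)" using ne Irr(3) unfolding p_def
    by (cases "CF.Irr K a") (simp_all add: no_trailing_unfold)
  have deg: "degree p = length (CF.Irr K a) - 1"
    by (simp add: degree_eq_length_coeffs c)
  have "p \<noteq> 0" using c ne by auto
  have lead: "lead_coeff p = 1"
    using last_coeffs_eq_coeff_degree[OF \<open>p \<noteq> 0\<close>] c Irr(3) ne by (simp add: last_rev)
  have "degree p \<le> degree g" if g: "g \<in> polys_over K" "g \<noteq> 0" "poly g a = 0" for g
  proof -
    have "rev (coeffs g) \<noteq> []" "CF.eval (rev (coeffs g)) a = 0"
      using g by (simp_all add: eval_complex_field)
    hence "length (CF.Irr K a) - 1 \<le> length (rev (coeffs g)) - 1"
      by (intro CF.pdivides_imp_degree_le[OF subfieldE(1)[OF K] Irr(1) rev_coeffs_carrier[OF g(1)]]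
          CF.Irr_minimal[OF K _ alg rev_coeffs_carrier[OF g(1)]]) simp_all
    thus ?thesis using deg by (simp add: degree_eq_length_coeffs[of g])
  qed
  moreover have "poly p a = 0" using Irr(4) by (simp add: eval_complex_field p_def)
  moreover have "p \<in> polys_over K" unfolding p_def by (rule Poly_rev_polys_over[OF K Irr(1)])
  ultimately show ?thesis using lead deg by (intro that) (auto simp: min_poly_over_def)
qed

lemma min_poly_over_dvd:
  assumes K: "subfield K complex_field" and p: "min_poly_over K a p"
    and g: "g \<in> polys_over K" "poly g a = 0"
  obtains q where "q \<in> polys_over K" "g = p * q"
proof -
  note K' = subfield_complex_fieldD[OF K]
  note p' = min_poly_overD[OF p]
  have "\<exists>q r. g = p * q + r \<and> (r = 0 \<or> degree r < degree p) \<and>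
      (\<forall>i. coeff q i \<in> K) \<and> (\<forall>i. coeff r i \<in> K)"
    by (rule monic_division) (use K' p' g in \<open>auto simp: polys_over_def\<close>)
  then obtain q r where qr: "g = p * q + r" "r = 0 \<or> degree r < degree p"
    "q \<in> polys_over K" "r \<in> polys_over K" by (auto simp: polys_over_def)
  have "poly r a = 0" using qr(1) g p'(4) by simp
  hence "r = 0" using qr(2) p'(6)[OF qr(4)] by (cases "r = 0") auto
  thus ?thesis using qr by (intro that) auto
qed

text \<open>The minimal polynomial \<open>m\<close> of \<open>x\<close> divides \<open>p\<close>. As
  \<open>a\<close> cannot be a root of the cofactor, whose degree is too small, it is a root of
  \<open>m\<close>, so \<open>m\<close> has the degree of \<open>p\<close>.\<close>

lemma min_poly_over_conjugate:
  assumes K: "subfield K complex_field" and p: "min_poly_over K a p" and x: "poly p x = 0"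
  shows "min_poly_over K x p"
proof -
  note p' = min_poly_overD[OF p]
  obtain m where m: "min_poly_over K x m"
    using ex_min_poly_over[OF K algebraic_overI[OF p'(1,3) x]] by blast
  note m' = min_poly_overD[OF m]
  obtain q where q: "q \<in> polys_over K" "p = m * q"
    by (rule min_poly_over_dvd[OF K m p'(1) x])
  have q0: "q \<noteq> 0" using q(2) p'(3) by auto
  hence deg: "degree p = degree m + degree q" using q(2) m'(3) by (simp add: degree_mult_eq)
  have "poly m a = 0 \<or> poly q a = 0" using p'(4) q(2) by simp
  hence "degree p \<le> degree m"
    using p'(6)[OF m'(1,3)] p'(6)[OF q(1) q0] deg m'(5) by auto
  thus ?thesis using p' m'(6) x unfolding min_poly_over_def by (meson le_trans)
qed

lemma polys_over_pderiv:
  assumes K: "subfield K complex_field" and "p \<in> polys_over K"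
  shows "pderiv p \<in> polys_over K"
  using assms(2)
  by (auto simp: polys_over_def coeff_pderiv simp del: of_nat_Suc
      intro!: subfield_complex_fieldD(4)[OF K] subfield_of_nat_closed[OF K])

text \<open>Separability in characteristic 0: a multiple root would be a root of the nonzero
  derivative, contradicting the minimality of \<open>p\<close> at that conjugate.\<close>

lemma min_poly_over_card_roots:
  assumes K: "subfield K complex_field" and p: "min_poly_over K a p"
  shows "card {x. poly p x = 0} = degree p"
proof -
  note p' = min_poly_overD[OF p]
  have "rsquarefree p"
    unfolding rsquarefree_roots
  proof safe
    fix x assume x: "poly p x = 0" "poly (pderiv p) x = 0"
    have "degree (pderiv p) = degree p - 1" by (rule degree_pderiv)
    moreover have "pderiv p \<noteq> 0" using p'(5) by (simp add: pderiv_eq_0_iff)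
    moreover note min_poly_overD(6)[OF min_poly_over_conjugate[OF K p x(1)]
        polys_over_pderiv[OF K p'(1)] _ x(2)]
    ultimately show False using p'(5) by simp
  qed
  from complex_poly_decompose_rsquarefree[OF this]
  have "degree p = degree (\<Prod>z|poly p z = 0. [:-z, 1:])"
    using p'(2) by simp
  also have "\<dots> = card {x. poly p x = 0}" by (subst degree_prod_eq_sum_degree) auto
  finally show ?thesis ..
qed

section \<open>Simple extensions and adjunction\<close>

text \<open>The inductive rule \<open>lin\<close> is a step of Horner's scheme and corresponds to
  \<open>pCons\<close>.\<close>

lemma simple_extension_eq_polys:
  assumes "subfield K complex_field"
  shows "CF.simple_extension K a = (\<lambda>g. poly g a) ` polys_over K"
proof (intro equalityI subsetI)
  fix x assume "x \<in> CF.simple_extension K a"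
  thus "x \<in> (\<lambda>g. poly g a) ` polys_over K"
  proof (induction rule: CF.simple_extension.induct)
    case zero
    show ?case using subfield_complex_fieldD(1)[OF assms]
      by (intro image_eqI[of _ _ 0]) (auto simp: polys_over_def)
  next
    case (lin k1 k2)
    then obtain g where "k1 = poly g a" "g \<in> polys_over K" by blast
    thus ?case using lin(2)
      by (intro image_eqI[of _ _ "pCons k2 g"]) (auto simp: polys_over_def coeff_pCons split: nat.splits)
  qed
next
  fix x assume "x \<in> (\<lambda>g. poly g a) ` polys_over K"
  then obtain g where g: "g \<in> polys_over K" "x = poly g a" by blast
  from g(1) have "poly g a \<in> CF.simple_extension K a"
  proof (induction g)
    case 0
    show ?case using CF.simple_extension.zero by simp
  next
    case (pCons c g)
    have "g \<in> polys_over K" "c \<in> K"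
      using pCons.prems by (auto simp: polys_over_def coeff_pCons split: nat.splits)
    thus ?case using CF.simple_extension.lin[of "poly g a" K a c] pCons.IH
      by (simp add: algebra_simps)
  qed
  thus "x \<in> CF.simple_extension K a" by (simp add: g)
qed

lemma adjoin_least:
  assumes "subfield E complex_field" "K \<subseteq> E" "S \<subseteq> E"
  shows "adjoin complex_field K S \<subseteq> E"
  unfolding adjoin_def by (rule field.generate_field_min_subfield1[OF field_from_type_algebra]) (use assms in auto)

lemma adjoin_incl: "K \<subseteq> adjoin R K S" "S \<subseteq> adjoin R K S"
  unfolding adjoin_def by (auto intro: generate_field.incl)

text \<open>Splitting off one generator makes \<rat>(\<alpha>, \<zeta>) a simple extension of
  \<rat>(\<zeta>).\<close>

lemma adjoin_insert:
  "adjoin complex_field K (insert a S) = adjoin complex_field (adjoin complex_field K S) {a}"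
proof (rule antisym)
  show "adjoin complex_field K (insert a S) \<subseteq> adjoin complex_field (adjoin complex_field K S) {a}"
  proof (rule adjoin_least[OF subfield_adjoin])
    have *: "adjoin complex_field K S \<subseteq> adjoin complex_field (adjoin complex_field K S) {a}"
      by (rule adjoin_incl)
    show "K \<subseteq> adjoin complex_field (adjoin complex_field K S) {a}"
      using adjoin_incl(1) * by (rule subset_trans)
    have "S \<subseteq> adjoin complex_field (adjoin complex_field K S) {a}"
      using adjoin_incl(2) * by (rule subset_trans)
    thus "insert a S \<subseteq> adjoin complex_field (adjoin complex_field K S) {a}"
      using adjoin_incl(2)[of "{a}"] by simp
  qed
  have "adjoin complex_field K S \<subseteq> adjoin complex_field K (insert a S)"
    using adjoin_incl(2)[of "insert a S" complex_field K]
    by (intro adjoin_least[OF subfield_adjoin] adjoin_incl(1)) auto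
  thus "adjoin complex_field (adjoin complex_field K S) {a} \<subseteq> adjoin complex_field K (insert a S)"
    by (rule adjoin_least[OF subfield_adjoin]) (use adjoin_incl(2)[of "insert a S" complex_field K] in auto)
qed

lemma adjoin_singleton_eq_simple_extension:
  assumes K: "subfield K complex_field" and alg: "(CF.algebraic over K) a"
  shows "adjoin complex_field K {a} = CF.simple_extension K a"
proof (rule antisym)
  have "subfield (CF.simple_extension K a) complex_field"
    using CF.simple_extension_is_subfield[OF K] alg by simp
  thus "adjoin complex_field K {a} \<subseteq> CF.simple_extension K a"
    using CF.simple_extension_incl[of K a] CF.simple_extension_mem[OF subfieldE(1)[OF K], of a]
    by (intro adjoin_least) auto
  show "CF.simple_extension K a \<subseteq> adjoin complex_field K {a}"
    using adjoin_incl[of K _ "{a}"] adjoin_incl(2)[of "{a}" _ K]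
    by (intro CF.simple_extension_subring_incl subfieldE(1)[OF subfield_adjoin]) auto
qed

section \<open>The trace as a sum over conjugates\<close>

lemma ex_lagrange_basis:
  fixes S :: "'a::field set"
  assumes "finite S"
  obtains l where "\<And>x. x \<in> S \<Longrightarrow> degree (l x) < card S"
    "\<And>x y. x \<in> S \<Longrightarrow> y \<in> S \<Longrightarrow> poly (l x) y = (if x = y then 1 else 0)"
proof -
  define P where "P x = (\<Prod>z\<in>S-{x}. [:-z, 1:])" for x
  define l where "l x = smult (inverse (poly (P x) x)) (P x)" for x
  show ?thesis
  proof (rule that[of l])
    fix x assume x: "x \<in> S"
    have "degree (P x) \<le> card (S - {x})"
      unfolding P_def by (subst degree_prod_eq_sum_degree) auto
    also have "\<dots> < card S" using assms x by (rule card_Diff1_less)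
    finally show "degree (l x) < card S" by (simp add: l_def)
    fix y assume y: "y \<in> S"
    have "poly (P x) x \<noteq> 0" using assms by (auto simp: P_def poly_prod)
    thus "poly (l x) y = (if x = y then 1 else 0)"
      using assms y by (auto simp: l_def P_def poly_prod)
  qed
qed

text \<open>The rows \<open>(x^e(0), x^e(1), \<dots>)\<close>, for the conjugates \<open>x\<close> of \<open>a\<close>, are left eigenvectors of the
  multiplication matrix, and the coefficients of the Lagrange polynomials form the inverse of the
  matrix with these rows. The exponents \<open>e\<close> are decreasing because \<open>exp_base\<close> is.\<close>

lemma field_trace_power_eq_sum_conjugates:
  assumes K: "subfield K complex_field" and p: "min_poly_over K a p"
  shows "CF.field_trace K (adjoin complex_field K {a}) (a ^ n) = (\<Sum>x | poly p x = 0. x ^ n)"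
proof -
  note K' = subfield_complex_fieldD[OF K]
  note p' = min_poly_overD[OF p]
  have alg: "(CF.algebraic over K) a" using p' by (intro algebraic_overI[of p])
  define S where "S = {x. poly p x = 0}"
  define d where "d = degree p"
  define e where "e j = d - Suc j" for j
  define Bs where "Bs = CF.exp_base a d"
  have S: "finite S" "card S = d"
    using p'(3) min_poly_over_card_roots[OF K p] by (auto simp: S_def d_def poly_roots_finite)
  \<comment> \<open>The basis property of \<open>CF.exp_base\<close> is phrased through
    \<open>CF.Irr\<close>, while \<open>d\<close> is the degree of the given
    \<open>p\<close>.\<close>
  have d: "d = length (CF.Irr K a) - 1"
  proof -
    obtain q where q: "min_poly_over K a q" "degree q = length (CF.Irr K a) - 1"
      by (rule ex_min_poly_over[OF K alg])
    have "degree p = degree q"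
      using min_poly_overD[OF q(1)] p' by (intro antisym) blast+
    thus ?thesis using q by (simp add: d_def)
  qed
  have len: "length Bs = d" by (simp add: Bs_def CF.exp_base_def)
  have nth: "Bs ! j = a ^ e j" if "j < d" for j
    using that by (simp add: Bs_def CF.exp_base_def rev_nth e_def)
  have L: "adjoin complex_field K {a} = CF.simple_extension K a"
    by (rule adjoin_singleton_eq_simple_extension[OF K alg])
  have basis: "CF.is_basis K (adjoin complex_field K {a}) Bs"
    unfolding CF.is_basis_def L Bs_def d
    using CF.exp_base_independent[OF K _ alg] CF.Span_exp_base[OF K _ alg] by simp
  have "a \<in> adjoin complex_field K {a}" by (rule subsetD[OF adjoin_incl(2)]) simp
  hence "a ^ n \<in> adjoin complex_field K {a}" by (rule subfield_power_closed[OF subfield_adjoin])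
  hence "\<exists>M. CF.mult_matrix K Bs (a ^ n) M"
    by (intro ex_mult_matrix[OF K basis] subfield_complex_fieldD(4)[OF subfield_adjoin])
  then obtain M where M: "CF.mult_matrix K Bs (a ^ n) M" ..
  have MK: "M i j \<in> K" and Meq: "a ^ n * a ^ e j = (\<Sum>i<d. M i j * a ^ e i)"
    if "i < d" "j < d" for i j
    using M that by (auto simp: CF.mult_matrix_def len nth combine_complex_field)
  \<comment> \<open>A polynomial relation over \<open>K\<close> that holds at \<open>a\<close> is
    divisible by \<open>p\<close> and so holds at every conjugate.\<close>
  have eig: "x ^ n * x ^ e j = (\<Sum>i<d. M i j * x ^ e i)" if x: "x \<in> S" and j: "j < d" for x j
  proof -
    define g where "g = monom 1 (n + e j) - (\<Sum>i<d. monom (M i j) (e i))"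
    have poly_g: "poly g y = y ^ n * y ^ e j - (\<Sum>i<d. M i j * y ^ e i)" for y
      by (simp add: g_def poly_sum poly_monom power_add)
    have sumK: "(\<Sum>i\<in>A. coeff (monom (M i j) (e i)) k) \<in> K" if "A \<subseteq> {..<d}" for A k
      using finite_subset[OF that finite_lessThan] that
      by (induction A rule: finite_induct) (use K' MK j in auto)
    hence "g \<in> polys_over K"
      using K'(3)[OF _ K'(5)[OF sumK[OF order_refl]], of "coeff (monom 1 (n + e j)) i" i for i] K'(1,2)
      by (simp add: polys_over_def g_def coeff_sum)
    moreover have "poly g a = 0" using Meq[OF j j] by (simp add: poly_g)
    ultimately obtain q where "g = p * q" using min_poly_over_dvd[OF K p] by blast
    hence "poly g x = 0" using x by (simp add: S_def)
    thus ?thesis by (simp add: poly_g)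
  qed
  obtain l where l: "\<And>x. x \<in> S \<Longrightarrow> degree (l x) < d"
    "\<And>x y. x \<in> S \<Longrightarrow> y \<in> S \<Longrightarrow> poly (l x) y = (if x = y then 1 else 0)"
    using ex_lagrange_basis[OF S(1)] S(2) by metis
  \<comment> \<open>Lagrange interpolation on \<open>S\<close> reproduces \<open>monom 1 k\<close>,
    as \<open>k < d\<close>; the coefficients at \<open>i\<close> are compared.\<close>
  have inv: "(\<Sum>x\<in>S. x ^ k * coeff (l x) i) = (if i = k then 1 else 0)" if k: "k < d" for k i
  proof -
    have "(\<Sum>x\<in>S. smult (x ^ k) (l x)) = monom 1 k"
    proof (rule poly_eqI_degree[of S])
      fix y assume "y \<in> S"
      thus "poly (\<Sum>x\<in>S. smult (x ^ k) (l x)) y = poly (monom 1 k) y"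
        using S(1) l(2) by (simp add: poly_sum poly_monom if_distrib[of "\<lambda>u. _ * u"] cong: if_cong)
    next
      have "degree (\<Sum>x\<in>S. smult (x ^ k) (l x)) < d"
        by (rule degree_sum_less) (use l(1) k in \<open>auto intro: le_less_trans[OF degree_smult_le]\<close>)
      thus "degree (\<Sum>x\<in>S. smult (x ^ k) (l x)) < card S" by (simp add: S)
      show "degree (monom (1::complex) k) < card S" using k S by (simp add: degree_monom_eq)
    qed
    from arg_cong[OF this, of "\<lambda>q. coeff q i"] show ?thesis by (simp add: coeff_sum)
  qed
  have one: "(\<Sum>j<d. x ^ e j * coeff (l x) (e j)) = 1" if x: "x \<in> S" for x
  proof -
    have "(\<Sum>j<d. x ^ e j * coeff (l x) (e j)) = (\<Sum>i<d. x ^ i * coeff (l x) i)"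
      unfolding e_def by (rule sum.nat_diff_reindex)
    also have "\<dots> = (\<Sum>i\<le>degree (l x). coeff (l x) i * x ^ i)"
      using l(1)[OF x] by (intro sum.mono_neutral_cong_right) (auto simp: coeff_eq_0 not_le)
    also have "\<dots> = 1" using l(2)[OF x x] by (simp add: poly_altdef)
    finally show ?thesis .
  qed
  \<comment> \<open>Inserting \<open>one\<close> and applying \<open>eig\<close> brings in the
    entries of \<open>M\<close>; summing over \<open>x\<close> first, \<open>inv\<close> leaves only
    the diagonal.\<close>
  have "(\<Sum>x\<in>S. x ^ n) = (\<Sum>x\<in>S. \<Sum>j<d. x ^ n * x ^ e j * coeff (l x) (e j))"
    using one by (simp add: mult.assoc flip: sum_distrib_left)
  also have "\<dots> = (\<Sum>x\<in>S. \<Sum>j<d. \<Sum>i<d. M i j * (x ^ e i * coeff (l x) (e j)))"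
    by (intro sum.cong refl) (simp add: eig sum_distrib_right mult.assoc)
  also have "\<dots> = (\<Sum>j<d. \<Sum>i<d. \<Sum>x\<in>S. M i j * (x ^ e i * coeff (l x) (e j)))"
    by (subst sum.swap, intro sum.cong refl, rule sum.swap)
  also have "\<dots> = (\<Sum>j<d. \<Sum>i<d. if i = j then M i j else 0)"
  proof (intro sum.cong refl)
    fix i j assume ij: "j \<in> {..<d}" "i \<in> {..<d}"
    hence "e i < d" "e j = e i \<longleftrightarrow> i = j" by (auto simp: e_def)
    thus "(\<Sum>x\<in>S. M i j * (x ^ e i * coeff (l x) (e j))) = (if i = j then M i j else 0)"
      using inv[of "e i" "e j"] by (simp flip: sum_distrib_left)
  qed
  also have "\<dots> = (\<Sum>j<d. M j j)" by simp
  also have "\<dots> = CF.field_trace K (adjoin complex_field K {a}) (a ^ n)"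
    using field_trace_eq[OF K basis M] by (simp add: len)
  finally show ?thesis by (simp add: S_def)
qed

section \<open>Torsion and roots of unity\<close>

lemma nat_pow_mult_of_complex_field [simp]:
  "x [^]\<^bsub>Multiplicative_Group.mult_of (complex_field\<lparr>carrier := F\<rparr>)\<^esub> (n::nat) = x ^ n"
  by (induction n) (simp_all add: nat_pow_def mult.commute)

lemma mem_torsion_iff:
  "x \<in> torsion (Multiplicative_Group.mult_of (complex_field\<lparr>carrier := F\<rparr>)) \<longleftrightarrow>
    x \<in> F \<and> x \<noteq> 0 \<and> (\<exists>n>0. x ^ n = 1)"
  by (auto simp: torsion_def)

text \<open>Multiplication by \<open>x\<close> permutes \<open>T\<close>, so the nonzero product
  over \<open>T\<close> equals \<open>x ^ card T\<close> times itself.\<close>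

lemma power_card_torsion_eq_1:
  assumes F: "subfield F complex_field"
  defines "T \<equiv> torsion (Multiplicative_Group.mult_of (complex_field\<lparr>carrier := F\<rparr>))"
  assumes T: "finite T" and x: "x \<in> T"
  shows "x ^ card T = 1"
proof -
  have T_iff: "y \<in> T \<longleftrightarrow> y \<in> F \<and> y \<noteq> 0 \<and> (\<exists>n>0. y ^ n = 1)" for y
    unfolding T_def by (rule mem_torsion_iff)
  have "x * y \<in> T" if y: "y \<in> T" for y
  proof -
    obtain m n where "m > 0" "x ^ m = 1" "n > 0" "y ^ n = 1" using x y by (auto simp: T_iff)
    moreover from this have "y ^ (m * n) = 1" by (subst mult.commute) (simp add: power_mult)
    ultimately have "(x * y) ^ (m * n) = 1" "m * n > 0"
      by (simp_all add: power_mult_distrib power_mult)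
    hence "\<exists>k>0. (x * y) ^ k = 1" by blast
    thus ?thesis using x y subfield_complex_fieldD(4)[OF F] by (simp add: T_iff)
  qed
  moreover have "inj_on ((*) x) T" using x by (auto simp: inj_on_def T_iff)
  ultimately have "bij_betw ((*) x) T T"
    using T by (intro bij_betw_imageI endo_inj_surj) auto
  hence "(\<Prod>y\<in>T. y) = (\<Prod>y\<in>T. x * y)" by (rule prod.reindex_bij_betw [symmetric])
  also have "\<dots> = x ^ card T * (\<Prod>y\<in>T. y)" by (simp add: prod.distrib)
  finally have "(x ^ card T - 1) * (\<Prod>y\<in>T. y) = 0" by (simp add: algebra_simps)
  moreover have "(\<Prod>y\<in>T. y) \<noteq> 0" using T by (simp add: T_iff)
  ultimately show ?thesis by simp
qed

lemma primitive_root_of_unity_complex_field: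
  assumes "primitive_root_of_unity complex_field h z"
  shows "h > 0" "z ^ n = 1 \<longleftrightarrow> h dvd n"
proof -
  interpret G: group "Multiplicative_Group.mult_of complex_field"
    by (rule field.field_mult_group[OF field_from_type_algebra])
  have "z [^]\<^bsub>Multiplicative_Group.mult_of complex_field\<^esub> n = z ^ n"
    using nat_pow_mult_of_complex_field[where x = z and F = UNIV and n = n] by (simp add: ring_of_type_algebra_def)
  thus "h > 0" "z ^ n = 1 \<longleftrightarrow> h dvd n"
    using assms G.pow_eq_id[of z n] by (auto simp: primitive_root_of_unity_def)
qed

text \<open>The first \<open>h\<close> powers of \<open>z\<close> are distinct, and there are
  exactly \<open>h\<close> complex \<open>h\<close>-th roots of unity.\<close>

lemma root_of_unity_eq_power:
  assumes z: "primitive_root_of_unity complex_field h z" and w: "w ^ h = 1"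
  obtains k where "w = z ^ k"
proof -
  note h = primitive_root_of_unity_complex_field[OF z]
  have z0: "z \<noteq> 0" using h(2)[of h] h(1) by (auto simp: power_0_left)
  have inj: "inj_on (\<lambda>k. z ^ k) {..<h}"
  proof (rule linorder_inj_onI)
    fix i j assume ij: "i < j" "i \<in> {..<h}" "j \<in> {..<h}"
    have "\<not> h dvd j - i" using ij by (auto dest: dvd_imp_le)
    hence "z ^ (j - i) \<noteq> 1" by (simp add: h(2))
    moreover have "z ^ j = z ^ i * z ^ (j - i)" using ij by (simp flip: power_add)
    ultimately show "z ^ i \<noteq> z ^ j" using z0 by simp
  qed auto
  have "(\<lambda>k. z ^ k) ` {..<h} = {w. w ^ h = 1}"
  proof (rule card_subset_eq)
    show "finite {w::complex. w ^ h = 1}" using finite_roots_unity[of h] h(1) by simp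
    show "card ((\<lambda>k. z ^ k) ` {..<h}) = card {w::complex. w ^ h = 1}"
      using card_roots_unity_eq[of h] h(1) by (simp add: card_image[OF inj])
    show "(\<lambda>k. z ^ k) ` {..<h} \<subseteq> {w. w ^ h = 1}"
      by (auto simp: h(2) simp flip: power_mult)
  qed
  thus ?thesis using w that by blast
qed

section \<open>Vanishing power sums of conjugates\<close>

text \<open>\<open>p(w X)\<close> has coefficients in \<open>K\<close> and shares a root with \<open>p\<close>, hence is divisible by \<open>p\<close>.\<close>

lemma min_poly_over_scaled_roots:
  assumes K: "subfield K complex_field" and p: "min_poly_over K a p"
    and w: "w \<in> K" and x: "poly p x = 0" "poly p (w * x) = 0" and y: "poly p y = 0"
  shows "poly p (w * y) = 0"
proof -
  have "pcompose p [:0, w:] \<in> polys_over K"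
    using min_poly_overD(1)[OF p] subfield_power_closed[OF K w] subfield_complex_fieldD(4)[OF K]
    by (simp add: polys_over_def coeff_pcompose_linear)
  moreover have eq: "poly (pcompose p [:0, w:]) z = poly p (w * z)" for z
    by (simp add: poly_pcompose mult.commute)
  ultimately obtain q where "pcompose p [:0, w:] = p * q"
    using min_poly_over_dvd[OF K min_poly_over_conjugate[OF K p x(1)], of "pcompose p [:0, w:]"] x(2)
    by auto
  thus ?thesis using y eq[of y] by simp
qed

text \<open>If \<open>a = g(a ^ h)\<close>, then \<open>X - g(X ^ h)\<close> vanishes at
  \<open>a\<close>, hence at its conjugate \<open>w * a\<close>, which forces \<open>w = 1\<close>.
  Conversely, the minimal polynomial of \<open>a\<close> over \<open>K(a ^ h)\<close> divides both
  \<open>p\<close> and \<open>X ^ h - a ^ h\<close>, so \<open>a\<close> is its only root and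
  separability makes it linear.\<close>

lemma mem_adjoin_power_iff:
  assumes K: "subfield K complex_field" and p: "min_poly_over K a p" and a: "a \<noteq> 0" and h: "h > 0"
  shows "a \<in> adjoin complex_field K {a ^ h} \<longleftrightarrow> (\<forall>w. w ^ h = 1 \<longrightarrow> poly p (w * a) = 0 \<longrightarrow> w = 1)"
proof
  note K' = subfield_complex_fieldD[OF K]
  note p' = min_poly_overD[OF p]
  have alg: "(CF.algebraic over K) a" using p' by (intro algebraic_overI[of p])
  assume "a \<in> adjoin complex_field K {a ^ h}"
  moreover have "(CF.algebraic over K) (a ^ h)"
  proof (rule CF.simple_extesion_mem_imp_algebraic[OF K _ alg])
    have "monom 1 h \<in> polys_over K" using K' by (simp add: polys_over_def)
    thus "a ^ h \<in> CF.simple_extension K a"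
      unfolding simple_extension_eq_polys[OF K]
      by (rule rev_image_eqI) (simp add: poly_monom)
  qed simp
  ultimately have "a \<in> (\<lambda>g. poly g (a ^ h)) ` polys_over K"
    by (simp add: adjoin_singleton_eq_simple_extension[OF K] simple_extension_eq_polys[OF K])
  then obtain g where g: "g \<in> polys_over K" "a = poly g (a ^ h)" by blast
  define f where "f = [:0, 1:] - pcompose g (monom 1 h)"
  have f: "poly f z = z - poly g (z ^ h)" for z
    by (simp add: f_def poly_pcompose poly_monom)
  have coeff_g: "coeff (pcompose g (monom 1 h)) i \<in> K" for i
  proof -
    have "degree (map_poly (\<lambda>c. [:c:]) g) = degree g" by (rule degree_map_poly) simp
    hence "pcompose g (monom 1 h) = (\<Sum>k\<le>degree g. smult (coeff g k) (monom 1 (k * h)))"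
      by (simp add: pcompose_altdef poly_altdef monom_power coeff_map_poly mult.commute)
    moreover have "(\<Sum>k\<in>A. coeff (smult (coeff g k) (monom 1 (k * h))) i) \<in> K" for A
      using g(1) K' by (induction A rule: infinite_finite_induct) (auto simp: polys_over_def)
    ultimately show ?thesis by (simp only: coeff_sum)
  qed
  have "coeff [:0, 1:] i \<in> K" for i
    using K' by (auto simp: coeff_pCons split: nat.splits)
  hence "f \<in> polys_over K"
    using K'(3)[OF _ K'(5)[OF coeff_g]] by (simp add: polys_over_def f_def del: coeff_pCons_0)
  then obtain q where "f = p * q"
    using min_poly_over_dvd[OF K p, of f] g(2) f by auto
  hence root: "poly f z = 0" if "poly p z = 0" for z using that by simp
  show "\<forall>w. w ^ h = 1 \<longrightarrow> poly p (w * a) = 0 \<longrightarrow> w = 1"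
  proof (intro allI impI)
    fix w assume "w ^ h = 1" "poly p (w * a) = 0"
    hence "w * a = a" using root[of "w * a"] f[of "w * a"] g(2) by (simp add: power_mult_distrib)
    thus "w = 1" using a by simp
  qed
next
  note p' = min_poly_overD[OF p]
  define M where "M = adjoin complex_field K {a ^ h}"
  have M: "subfield M complex_field" unfolding M_def by (rule subfield_adjoin)
  note M' = subfield_complex_fieldD[OF M]
  have "K \<subseteq> M" unfolding M_def by (rule adjoin_incl)
  hence pM: "p \<in> polys_over M" using p' polys_over_mono by blast
  have ahM: "a ^ h \<in> M" unfolding M_def using adjoin_incl(2)[of "{a ^ h}" complex_field K] by simp
  obtain q where q: "min_poly_over M a q"
    using ex_min_poly_over[OF M algebraic_overI[OF pM p'(3,4)]] by blast
  note q' = min_poly_overD[OF q]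
  obtain r where r: "p = q * r" by (rule min_poly_over_dvd[OF M q pM p'(4)])
  have "monom 1 h + [:- (a ^ h):] \<in> polys_over M"
    using M' ahM unfolding polys_over_def coeff_add by (auto simp: coeff_pCons split: nat.splits)
  then obtain s where s: "monom 1 h + [:- (a ^ h):] = q * s"
    by (rule min_poly_over_dvd[OF M q]) (simp add: poly_monom)
  assume triv: "\<forall>w. w ^ h = 1 \<longrightarrow> poly p (w * a) = 0 \<longrightarrow> w = 1"
  have "x = a" if x: "poly q x = 0" for x
  proof -
    have "poly (monom 1 h + [:- (a ^ h):]) x = 0" using x by (simp add: s)
    hence "(x / a) ^ h = 1" using a by (simp add: poly_monom power_divide)
    moreover have "poly p (x / a * a) = 0" using x a by (simp add: r)
    ultimately have "x / a = 1" using triv by blast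
    thus ?thesis using a by simp
  qed
  hence "{x. poly q x = 0} = {a}" using q'(4) by blast
  hence deg: "degree q = 1" using min_poly_over_card_roots[OF M q] by simp
  hence "a = - coeff q 0"
    using q'(2,4) by (simp add: poly_altdef eq_neg_iff_add_eq_0 add.commute)
  moreover have "coeff q 0 \<in> M" using q'(1) by (simp add: polys_over_def)
  ultimately show "a \<in> M" using M'(5) by metis
qed

text \<open>The assumptions \<open>units\<close> and \<open>ratio\<close> isolate what the presence
  of \<zeta> in the base field and the choice of \<open>h\<close> as the torsion order
  provide.\<close>

theorem infinite_sum_conjugates_eq_0_iff:
  assumes K: "subfield K complex_field" and p: "min_poly_over K a p"
    and a: "a \<noteq> 0" "algebraic a" and h: "h > 0" and units: "\<And>w. w ^ h = 1 \<Longrightarrow> w \<in> K"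
    and ratio: "\<And>x y N. poly p x = 0 \<Longrightarrow> poly p y = 0 \<Longrightarrow> N > 0 \<Longrightarrow> x ^ N = y ^ N \<Longrightarrow> x ^ h = y ^ h"
  shows "infinite {n. (\<Sum>x | poly p x = 0. x ^ n) = 0} \<longleftrightarrow> a \<notin> adjoin complex_field K {a ^ h}"
proof -
  note K' = subfield_complex_fieldD[OF K]
  note p' = min_poly_overD[OF p]
  define S where "S = {x. poly p x = 0}"
  have S: "finite S" "a \<in> S" using p' by (auto simp: S_def poly_roots_finite)
  \<comment> \<open>If \<open>0\<close> were a conjugate, \<open>p\<close> would divide
    \<open>X\<close>, and its root \<open>a\<close> would be \<open>0\<close>.\<close>
  have zero: "0 \<notin> S"
  proof
    assume "0 \<in> S"
    hence min0: "min_poly_over K 0 p" using min_poly_over_conjugate[OF K p] by (simp add: S_def)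
    have "[:0, 1:] \<in> polys_over K"
      using K' by (auto simp: polys_over_def coeff_pCons split: nat.splits)
    then obtain q where "[:0, 1:] = p * q" by (rule min_poly_over_dvd[OF K min0]) simp
    hence "poly [:0, 1:] a = 0" using p'(4) by simp
    thus False using a by simp
  qed
  have alg: "algebraic x" if "x \<in> S" for x
  proof -
    obtain f where f: "f \<in> polys_over K" "\<And>i. coeff f i \<in> \<int>" "f \<noteq> 0" "poly f a = 0"
      using algebraicE_over[OF K a(2)] by blast
    obtain q where "f = p * q" by (rule min_poly_over_dvd[OF K p f(1,4)])
    thus ?thesis using that f by (intro algebraicI[of f]) (auto simp: S_def)
  qed
  have "infinite {n. (\<Sum>x\<in>S. x ^ n) = 0} \<longleftrightarrow> (\<exists>w. w ^ h = 1 \<and> poly p (w * a) = 0 \<and> w \<noteq> 1)"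
  proof
    assume "infinite {n. (\<Sum>x\<in>S. x ^ n) = 0}"
    hence "\<exists>N>0. \<exists>x\<in>S. \<exists>y\<in>S. x \<noteq> y \<and> x ^ N = y ^ N"
      using S by (intro skolem_mahler_lech_nondegenerate[where c = "\<lambda>_. 1"] alg zero) auto
    then obtain N x y where N: "N > 0" and xy: "x \<in> S" "y \<in> S" "x \<noteq> y" "x ^ N = y ^ N" by blast
    have y0: "y \<noteq> 0" using xy zero by auto
    have "x ^ h = y ^ h" using N xy by (intro ratio) (auto simp: S_def)
    hence 1: "(x / y) ^ h = 1" using y0 by (simp add: power_divide)
    \<comment> \<open>Multiplication by \<open>x / y\<close> sends the conjugate \<open>y\<close> to
      the conjugate \<open>x\<close>, hence \<open>a\<close> to a conjugate as well.\<close>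
    have "poly p (x / y * a) = 0"
      by (rule min_poly_over_scaled_roots[OF K p units[OF 1], of y])
         (use xy y0 S in \<open>auto simp: S_def\<close>)
    thus "\<exists>w. w ^ h = 1 \<and> poly p (w * a) = 0 \<and> w \<noteq> 1"
      using 1 xy(3) y0 by (intro exI[of _ "x / y"]) simp
  next
    assume "\<exists>w. w ^ h = 1 \<and> poly p (w * a) = 0 \<and> w \<noteq> 1"
    then obtain w where w: "w ^ h = 1" "poly p (w * a) = 0" "w \<noteq> 1" by blast
    have w0: "w \<noteq> 0" using w(1) h by (auto simp: power_0_left)
    have "w * x \<in> S" if "x \<in> S" for x
      using min_poly_over_scaled_roots[OF K p units[OF w(1)] p'(4) w(2)] that by (simp add: S_def)
    moreover have "inj_on ((*) w) S" using w0 by (auto simp: inj_on_def)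
    ultimately have "bij_betw ((*) w) S S"
      using S(1) by (intro bij_betw_imageI endo_inj_surj) auto
    hence "(\<Sum>x\<in>S. (w * x) ^ n) = (\<Sum>x\<in>S. x ^ n)" for n
      by (rule sum.reindex_bij_betw)
    hence eq: "w ^ n * (\<Sum>x\<in>S. x ^ n) = (\<Sum>x\<in>S. x ^ n)" for n
      by (simp add: power_mult_distrib flip: sum_distrib_left)
    \<comment> \<open>For these exponents \<open>w ^ n = w\<close>, and \<open>w \<noteq> 1\<close>
      forces the sum to vanish.\<close>
    have "(\<Sum>x\<in>S. x ^ n) = 0" if "n \<in> range (\<lambda>k. h * k + 1)" for n
    proof -
      have "w ^ n = w" using that w(1) by (auto simp: power_mult)
      thus ?thesis using eq[of n] w(3) by auto
    qed
    hence "range (\<lambda>k. h * k + 1) \<subseteq> {n. (\<Sum>x\<in>S. x ^ n) = 0}" by blast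
    moreover have "infinite (range (\<lambda>k. h * k + 1))"
      using h by (intro range_inj_infinite) (auto simp: inj_def)
    ultimately show "infinite {n. (\<Sum>x\<in>S. x ^ n) = 0}" by (rule infinite_super)
  qed
  thus ?thesis using mem_adjoin_power_iff[OF K p a(1) h] unfolding S_def by blast
qed

theorem theorem1p10:
  fixes \<alpha> \<zeta> :: complex and h :: nat
  assumes "\<alpha> \<noteq> 0" and "algebraic \<alpha>"
    and "h = card (torsion (Multiplicative_Group.mult_of
           (complex_field\<lparr>carrier :=
              splitting_field complex_field \<rat> (ring.Irr complex_field \<rat> \<alpha>)\<rparr>)))"
    and "primitive_root_of_unity complex_field h \<zeta>"
  shows "infinite {n::nat. ring.field_trace complex_field
             (adjoin complex_field \<rat> {\<zeta>}) (adjoin complex_field \<rat> {\<alpha>, \<zeta>}) (\<alpha> ^ n) = 0}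
         \<longleftrightarrow> \<alpha> \<notin> adjoin complex_field \<rat> {\<alpha> ^ h, \<zeta>}"
proof -
  define K where "K = adjoin complex_field \<rat> {\<zeta>}"
  define F where "F = splitting_field complex_field \<rat> (CF.Irr \<rat> \<alpha>)"
  define T where "T = torsion (Multiplicative_Group.mult_of (complex_field\<lparr>carrier := F\<rparr>))"
  have K: "subfield K complex_field" unfolding K_def by (rule subfield_adjoin)
  have F: "subfield F complex_field" unfolding F_def splitting_field_def by (rule subfield_adjoin)
  have h: "h > 0" by (rule primitive_root_of_unity_complex_field[OF assms(4)])
  have hT: "h = card T" using assms(3) by (simp add: T_def F_def)
  \<comment> \<open>\<open>card\<close> is 0 on infinite sets, so a positive \<open>h\<close>
    excludes an infinite torsion group.\<close>
  hence T: "finite T" using h by (auto intro: card_ge_0_finite)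
  obtain p where p: "min_poly_over K \<alpha> p"
    using ex_min_poly_over[OF K algebraic_imp_algebraic_over[OF K assms(2)]] by blast
  note p' = min_poly_overD[OF p]
  note Irr = CF.IrrE[OF subfield_Rats _ algebraic_imp_algebraic_over[OF subfield_Rats assms(2)], simplified]
  \<comment> \<open>Over the larger field \<open>K\<close>, \<open>p\<close> divides the rational
    minimal polynomial of \<alpha>, so its roots lie in the splitting field.\<close>
  have root_F: "x \<in> F" if x: "poly p x = 0" for x
  proof -
    have "Poly (rev (CF.Irr \<rat> \<alpha>)) \<in> polys_over K"
      unfolding K_def
      by (rule subsetD[OF polys_over_mono[OF adjoin_incl(1)] Poly_rev_polys_over[OF subfield_Rats Irr(1)]])
    then obtain q where "Poly (rev (CF.Irr \<rat> \<alpha>)) = p * q"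
      by (rule min_poly_over_dvd[OF K p]) (use Irr(4) in \<open>simp add: eval_complex_field\<close>)
    hence "CF.eval (CF.Irr \<rat> \<alpha>) x = 0" using x by (simp add: eval_complex_field)
    moreover have "CF.Irr \<rat> \<alpha> \<noteq> []"
      using Irr(2) by (auto simp: ring_irreducible_def univ_poly_zero)
    ultimately have "CF.is_root (CF.Irr \<rat> \<alpha>) x" by (simp add: CF.is_root_def)
    thus ?thesis
      unfolding F_def splitting_field_def by (intro subsetD[OF adjoin_incl(2)]) simp
  qed
  \<comment> \<open>The ratio of two nonzero conjugates with equal \<open>N\<close>-th powers is a
    torsion element of \<open>F\<close>, so its order divides \<open>h\<close>.\<close>
  have ratio: "x ^ h = y ^ h" if xy: "poly p x = 0" "poly p y = 0" and N: "N > 0" "x ^ N = y ^ N" for x y N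
  proof (cases "y = 0")
    case True
    thus ?thesis using N by (auto simp: power_0_left split: if_splits)
  next
    case False
    have "x \<noteq> 0" using N False by (auto simp: power_0_left)
    have "x * inverse y \<in> F"
      using subfield_complex_fieldD(4,6)[OF F] root_F xy by blast
    moreover have "(x * inverse y) ^ N = 1"
      using N(2) False by (simp add: power_mult_distrib power_inverse)
    ultimately have "x * inverse y \<in> T"
      using \<open>x \<noteq> 0\<close> False N(1) by (auto simp: T_def mem_torsion_iff)
    hence "(x * inverse y) ^ h = 1"
      using power_card_torsion_eq_1[OF F] T unfolding hT T_def by blast
    thus ?thesis using False by (simp add: power_mult_distrib power_inverse field_simps)
  qed
  have units: "w \<in> K" if w: "w ^ h = 1" for w
  proof -
    obtain k where "w = \<zeta> ^ k" by (rule root_of_unity_eq_power[OF assms(4) w])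
    moreover have "\<zeta> \<in> K" unfolding K_def by (rule subsetD[OF adjoin_incl(2)]) simp
    ultimately show ?thesis using subfield_power_closed[OF K] by simp
  qed
  have adjoin: "adjoin complex_field \<rat> {x, \<zeta>} = adjoin complex_field K {x}" for x
    unfolding K_def by (rule adjoin_insert)
  have "infinite {n. (\<Sum>x | poly p x = 0. x ^ n) = 0} \<longleftrightarrow> \<alpha> \<notin> adjoin complex_field K {\<alpha> ^ h}"
    by (rule infinite_sum_conjugates_eq_0_iff[OF K p assms(1,2) h]) (fact units, fact ratio)
  thus ?thesis
    unfolding adjoin field_trace_power_eq_sum_conjugates[OF K p, symmetric] unfolding K_def .
qed

end
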